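(* Let $C$ be the Cesàro operator on $L^2(0,1)$, $(Cf)(x)=\frac1x\int_0^x\frac{f(t)}{1-t}\,dt$ for $0<x<1$, and for $t\ge0$ let $S_t$ be the weighted composition operator on $L^2(0,1)$ defined by $$(S_tf)(x)=\frac{\phi_t(x)}{x}f(\phi_t(x)),\qquad \phi_t(x)=\frac{e^{-t}x}{(e^{-t}-1)x+1}.$$ For a closed subspace $\mathcal{M}$ of $L^2(0,1)$, the following are equivalent: (a) $C\mathcal{M}\subseteq\mathcal{M}$; (b) $S_t\mathcal{M}\subseteq\mathcal{M}$ for all $t\ge0$.
   Context: $L^2(0,1)$ is the Hilbert space of complex-valued square-integrable functions on $(0,1)$ with respect to Lebesgue measure; $C$ and each $S_t$ are bounded linear operators on it. Each $\phi_t$ maps $[0,1]$ bijectively onto $[0,1]$. *)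

theory Defs
  imports "HOL-Analysis.Analysis"
begin

text \<open>
  The elements of \<open>L\<^sup>2(0,1)\<close> are represented by functions, not by classes modulo almost everywhere
  equality; their values outside \<open>(0,1)\<close> are irrelevant. The seminorm \<open>L2_norm\<close> below
  is the norm of the class. A closed subspace of the Hilbert space corresponds to
  the set of all representatives of its elements; the lemma \<open>L2_closed_subspace_AE\<close>
  shows that \<open>L2_closed_subspace\<close> only admits sets saturated in this sense.
\<close>

abbreviation unit_measure :: "real measure"
  where "unit_measure \<equiv> lebesgue_on {0<..<1}"

definition L2 :: "(real \<Rightarrow> complex) set"
  where "L2 = {f \<in> borel_measurable unit_measure. integrable unit_measure (\<lambda>x. (cmod (f x))\<^sup>2)}"

definition L2_norm :: "(real \<Rightarrow> complex) \<Rightarrow> real"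
  where "L2_norm f = sqrt (LINT x|unit_measure. (cmod (f x))\<^sup>2)"

definition L2_subspace :: "(real \<Rightarrow> complex) set \<Rightarrow> bool"
  where "L2_subspace M \<longleftrightarrow>
    M \<subseteq> L2 \<and> (\<lambda>x. 0) \<in> M \<and>
    (\<forall>f\<in>M. \<forall>g\<in>M. (\<lambda>x. f x + g x) \<in> M) \<and>
    (\<forall>c::complex. \<forall>f\<in>M. (\<lambda>x. c * f x) \<in> M)"

definition L2_closed :: "(real \<Rightarrow> complex) set \<Rightarrow> bool"
  where "L2_closed M \<longleftrightarrow>
    (\<forall>f g. (\<forall>n::nat. f n \<in> M) \<and> g \<in> L2 \<and> (\<lambda>n. L2_norm (\<lambda>x. f n x - g x)) \<longlonglongrightarrow> 0 \<longrightarrow> g \<in> M)"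

definition L2_closed_subspace :: "(real \<Rightarrow> complex) set \<Rightarrow> bool"
  where "L2_closed_subspace M \<longleftrightarrow> L2_subspace M \<and> L2_closed M"

lemma L2_closed_subspace_AE:
  assumes M: "L2_closed_subspace M" and f: "f \<in> M"
    and g: "g \<in> borel_measurable unit_measure" and eq: "AE x in unit_measure. f x = g x"
  shows "g \<in> M"
proof -
  have fL2: "f \<in> L2"
    using M f by (auto simp: L2_closed_subspace_def L2_subspace_def)
  then have f': "f \<in> borel_measurable unit_measure"
    and fi: "integrable unit_measure (\<lambda>x. (cmod (f x))\<^sup>2)"
    by (auto simp: L2_def)
  have "integrable unit_measure (\<lambda>x. (cmod (g x))\<^sup>2)"
  proof (rule integrable_cong_AE_imp[OF fi])
    show "(\<lambda>x. (cmod (g x))\<^sup>2) \<in> borel_measurable unit_measure"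
      using g by measurable
    show "AE x in unit_measure. (cmod (f x))\<^sup>2 = (cmod (g x))\<^sup>2"
      using eq by (auto elim: eventually_mono)
  qed
  then have gL2: "g \<in> L2"
    using g by (simp add: L2_def)
  have "(LINT x|unit_measure. (cmod (f x - g x))\<^sup>2) = (LINT x|unit_measure. 0)"
  proof (rule integral_cong_AE)
    show "(\<lambda>x. (cmod (f x - g x))\<^sup>2) \<in> borel_measurable unit_measure"
      using f' g by measurable
    show "AE x in unit_measure. (cmod (f x - g x))\<^sup>2 = 0"
      using eq by (auto elim: eventually_mono)
  qed simp
  then have "L2_norm (\<lambda>x. f x - g x) = 0"
    by (simp add: L2_norm_def)
  then have lim: "(\<lambda>n::nat. L2_norm (\<lambda>x. f x - g x)) \<longlonglongrightarrow> 0"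
    by simp
  have "L2_closed M"
    using M by (simp add: L2_closed_subspace_def)
  from this[unfolded L2_closed_def, rule_format, of "\<lambda>n. f" g] show ?thesis
    using f gL2 lim by blast
qed

definition cesaro :: "(real \<Rightarrow> complex) \<Rightarrow> real \<Rightarrow> complex"
  where "cesaro f x = complex_of_real (1 / x) *
    (LINT t:{0<..<x}|lebesgue. f t / complex_of_real (1 - t))"

definition phi :: "real \<Rightarrow> real \<Rightarrow> real"
  where "phi t x = exp (-t) * x / ((exp (-t) - 1) * x + 1)"

definition weighted_comp :: "real \<Rightarrow> (real \<Rightarrow> complex) \<Rightarrow> real \<Rightarrow> complex"
  where "weighted_comp t f x = complex_of_real (phi t x / x) * f (phi t x)"

end

theory Submission
  imports Defs
begin

text \<open>
  Put \<open>y = x / (1 - x)\<close>. Then \<open>\<phi>\<^sub>t\<close> is the dilation \<open>y \<mapsto> exp (-t) * y\<close>, so the operators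
  \<open>S\<^sub>t\<close> form a semigroup, and \<open>\<parallel>S\<^sub>t f\<parallel>\<^sup>2 = exp (-t) * \<parallel>f\<parallel>\<^sup>2\<close> (\<open>sqnorm_weighted_comp\<close>). In the
  variable \<open>t\<close> the integral that defines the Cesaro operator becomes
  \<open>C f = \<integral>\<^sub>0\<^sup>\<infinity> S\<^sub>s f ds\<close> (\<open>cesaro_eq_time_average\<close>); in other words \<open>C\<close> is minus the inverse
  of the generator of the semigroup. The theorem says that such a semigroup and this inverse have
  the same closed invariant subspaces.

  One direction is the approximation of \<open>\<integral>\<^sub>0\<^sup>\<infinity> S\<^sub>s f ds\<close> by Riemann sums
  (\<open>riemann_sums_tendsto\<close>), which rests on the strong continuity of the semigroup
  (\<open>weighted_comp_strongly_continuous\<close>).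

  For the other direction consider the averages \<open>T\<^sub>k f = \<integral>\<^sub>0\<^sup>\<infinity> k(s) S\<^sub>s f ds\<close> for kernels \<open>k\<close>
  that grow at most like \<open>exp (3 * s / 8)\<close>; the decay \<open>exp (- s / 2)\<close> of \<open>\<parallel>S\<^sub>s\<parallel>\<close> makes \<open>T\<^sub>k\<close>
  bounded. Suppose that \<open>C M \<subseteq> M\<close> and call \<open>k\<close> invariant if \<open>T\<^sub>k M \<subseteq> M\<close>. The kernel
  \<open>1\<close> is invariant, since \<open>T\<^sub>1 = C\<close>. The invariant kernels form a vector space that is closed under
  pointwise limits with a uniform growth bound (\<open>invariant_kernel_limit\<close>). The class grows as follows.
  The semigroup law and Fubini's theorem show that \<open>C T\<^sub>k\<close>, for \<open>k = s\<^sup>n\<close>, is the average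
  with kernel \<open>s\<^sup>n\<^sup>+\<^sup>1 / (n + 1)\<close>, so all polynomials are invariant.
  Multiplication by the Taylor series of \<open>exp (- s / 4)\<close> gives the kernels
  \<open>s\<^sup>n * exp (- j * s / 4)\<close>, in particular all polynomials in \<open>u = exp (- s / 4)\<close>. Bernstein approximation in
  \<open>u \<in> [0,1]\<close> then gives the indicator functions of the half-lines \<open>(t, \<infinity>)\<close>
  (\<open>invariant_kernel_tail\<close>). Difference quotients of these are approximate point masses at \<open>t\<close>,
  and by strong continuity the corresponding averages converge to \<open>S\<^sub>t f\<close>
  (\<open>sqnorm_difference_quotient_tendsto\<close>).

  All norm estimates for integrals over time come from one inequality
  (\<open>sqnorm_time_integral_le\<close>), which is the Cauchy-Schwarz inequality in the time variable
  combined with Tonelli's theorem.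
  The analysis is done for Borel functions, for which the joint measurability of
  \<open>(s, x) \<mapsto> S\<^sub>s F x\<close> is clear. A closed subspace contains with each function also
  a Borel function that agrees with it almost everywhere, and both operators respect almost
  everywhere equality, so this loses nothing.
\<close>

section \<open>The flow and its weighted composition operators\<close>

text \<open>
  The extended nonnegative values allow Tonelli's theorem and dominated convergence to be used
  before any integrability is known.
\<close>

definition sqnorm :: "(real \<Rightarrow> complex) \<Rightarrow> ennreal"
  where "sqnorm f = (\<integral>\<^sup>+x\<in>{0<..<1}. ennreal ((cmod (f x))\<^sup>2) \<partial>lborel)"

lemma phi_denominator_pos:
  assumes "0 < x" "x < 1"
  shows "0 < (exp (-s) - 1) * x + (1::real)"
proof -
  have "0 < exp (-s) * x + (1 - x)"
    using assms by (intro add_pos_pos mult_pos_pos) auto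
  then show ?thesis by (simp add: algebra_simps)
qed

lemma phi_pos: "0 < x \<Longrightarrow> x < 1 \<Longrightarrow> 0 < phi s x"
  unfolding phi_def by (intro divide_pos_pos phi_denominator_pos) auto

lemma phi_less_1: "0 < x \<Longrightarrow> x < 1 \<Longrightarrow> phi s x < 1"
  using phi_denominator_pos[of x s] by (simp add: phi_def field_simps)

lemma phi_le: 
  assumes "0 < x" "x < 1" "0 \<le> s"
  shows "phi s x \<le> x"
proof -
  have "0 \<le> x * ((1 - exp (-s)) * (1 - x))"
    using assms by (intro mult_nonneg_nonneg) auto
  then have "exp (-s) * x \<le> x * ((exp (-s) - 1) * x + 1)"
    by (simp add: algebra_simps)
  then show ?thesis
    using phi_denominator_pos[of x s] assms by (simp add: phi_def field_simps)
qed

lemma phi_0 [simp]: "phi 0 x = x"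
  by (simp add: phi_def)

lemma phi_phi:
  assumes "0 < x" "x < 1"
  shows "phi s (phi t x) = phi (s + t) x"
proof -
  define a b where "a = exp (-s)" and "b = exp (-t)"
  have ab: "exp (-(s + t)) = a * b"
    by (simp add: a_def b_def exp_add[symmetric])
  define d where "d = (b - 1) * x + 1"
  have d: "d > 0" unfolding d_def b_def by (rule phi_denominator_pos[OF assms])
  have e: "(a * b - 1) * x + 1 > 0" unfolding ab[symmetric] by (rule phi_denominator_pos[OF assms])
  have "phi s (phi t x) = a * (b * x / d) / ((a - 1) * (b * x / d) + 1)"
    by (simp add: phi_def a_def b_def d_def)
  also have "(a - 1) * (b * x / d) + 1 = ((a * b - 1) * x + 1) / d"
    using d by (simp add: field_simps d_def)
  also have "a * (b * x / d) / (((a * b - 1) * x + 1) / d) = a * b * x / ((a * b - 1) * x + 1)"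
    using d e by (simp add: field_simps)
  also have "\<dots> = phi (s + t) x"
    by (simp add: phi_def ab[symmetric])
  finally show ?thesis .
qed

lemma weighted_comp_weighted_comp:
  assumes "0 < x" "x < 1"
  shows "weighted_comp s (weighted_comp t f) x = weighted_comp (s + t) f x"
  using phi_phi[OF assms, of t s] phi_pos[OF assms, of s]
  by (simp add: weighted_comp_def add.commute)

lemma measurable_phi [measurable]:
  assumes [measurable]: "f \<in> borel_measurable N" "g \<in> borel_measurable N"
  shows "(\<lambda>w. phi (f w) (g w)) \<in> borel_measurable N"
  unfolding phi_def by measurable

lemma measurable_weighted_comp [measurable]:
  assumes [measurable]: "F \<in> borel_measurable borel" "f \<in> borel_measurable N" "g \<in> borel_measurable N"
  shows "(\<lambda>w. weighted_comp (f w) F (g w)) \<in> borel_measurable N"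
  unfolding weighted_comp_def by measurable

lemma phi_has_derivative:
  assumes "(exp (-s) - 1) * x + 1 \<noteq> 0"
  shows "((\<lambda>x. phi s x) has_real_derivative exp (-s) / ((exp (-s) - 1) * x + 1)\<^sup>2) (at x within A)"
  unfolding phi_def using assms
  by (auto intro!: derivative_eq_intros simp: field_simps power2_eq_square)

text \<open>
  In the coordinate \<open>y = x / (1 - x)\<close> this is the equation \<open>dy/ds = - y\<close> of a dilation. It turns
  the measure \<open>dt / (t (1 - t))\<close> hidden in the Cesaro operator into \<open>ds\<close>.
\<close>

lemma phi_has_derivative_time:
  assumes "0 < x" "x < 1"
  shows "((\<lambda>s. phi s x) has_real_derivative - (phi s x * (1 - phi s x))) (at s within A)"
proof -
  define d where "d = (exp (-s) - 1) * x + 1"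
  have d: "d > 0" unfolding d_def by (rule phi_denominator_pos[OF assms])
  have "((\<lambda>s. phi s x) has_real_derivative (- (exp (-s) * x) * d + exp (-s) * x * (exp (-s) * x)) / (d * d)) (at s within A)"
    unfolding phi_def d_def using d[unfolded d_def]
    by (auto intro!: derivative_eq_intros)
  moreover have "phi s x = exp (-s) * x / d" by (simp add: phi_def d_def)
  moreover have "(- (exp (-s) * x) * d + exp (-s) * x * (exp (-s) * x)) / (d * d) = - (exp (-s) * x / d * (1 - exp (-s) * x / d))"
    using d by (simp add: field_simps)
  ultimately show ?thesis by simp
qed

text \<open>
  The substitution \<open>y = \<phi>\<^sub>s(x)\<close>; the squared weight is exactly \<open>exp (-s) * \<phi>\<^sub>s'(x)\<close>. With \<open>h\<close> an
  indicator function the same formula shows that \<open>\<phi>\<^sub>s\<close> pulls null sets back to null sets.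
\<close>

lemma nn_integral_weighted_phi:
  assumes [measurable]: "h \<in> borel_measurable borel"
  shows "(\<integral>\<^sup>+x\<in>{0<..<1}. ennreal ((phi s x / x)\<^sup>2) * h (phi s x) \<partial>lborel)
    = ennreal (exp (-s)) * (\<integral>\<^sup>+x\<in>{0<..<1}. h x \<partial>lborel)"
proof -
  define g' where "g' = (\<lambda>x. exp (-s) / ((exp (-s) - 1) * x + 1)\<^sup>2)"
  have ends: "AE x in lborel. x \<noteq> 0 \<and> x \<noteq> (1::real)"
    using AE_lborel_singleton[of 0] AE_lborel_singleton[of "1::real"] by eventually_elim simp
  have den: "0 < (exp (-s) - 1) * x + 1" if "x \<in> {0..1}" for x
  proof (cases "x = 0 \<or> x = 1")
    case False
    then show ?thesis using that phi_denominator_pos[of x s] by auto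
  qed auto
  have "(\<integral>\<^sup>+x\<in>{0<..<1}. h x \<partial>lborel) = (\<integral>\<^sup>+x. h x * indicator {phi s 0..phi s 1} x \<partial>lborel)"
    by (rule nn_integral_cong_AE) (use ends in \<open>eventually_elim, auto simp: phi_def indicator_def\<close>)
  also have "\<dots> = (\<integral>\<^sup>+x. h (phi s x) * ennreal (g' x) * indicator {0..1} x \<partial>lborel)"
  proof (rule nn_integral_substitution_aux)
    show "(phi s has_real_derivative g' x) (at x)" if "x \<in> {0..1}" for x
      using phi_has_derivative[of s x UNIV] den[OF that] by (simp add: g'_def)
    show "continuous_on {0..1} g'"
      unfolding g'_def using den by (force intro!: continuous_intros)
    show "0 \<le> g' x" for x by (simp add: g'_def)
  qed auto
  finally have "ennreal (exp (-s)) * (\<integral>\<^sup>+x\<in>{0<..<1}. h x \<partial>lborel)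
      = ennreal (exp (-s)) * (\<integral>\<^sup>+x. h (phi s x) * ennreal (g' x) * indicator {0..1} x \<partial>lborel)"
    by simp
  also have "\<dots> = (\<integral>\<^sup>+x. ennreal (exp (-s)) * (h (phi s x) * ennreal (g' x) * indicator {0..1} x) \<partial>lborel)"
    unfolding g'_def by (rule nn_integral_cmult[symmetric]) measurable
  also have "\<dots> = (\<integral>\<^sup>+x\<in>{0<..<1}. ennreal ((phi s x / x)\<^sup>2) * h (phi s x) \<partial>lborel)"
  proof (rule nn_integral_cong_AE, use ends in eventually_elim)
    fix x :: real assume x: "x \<noteq> 0 \<and> x \<noteq> 1"
    have "(phi s x / x)\<^sup>2 = exp (-s) * g' x"
      using x by (simp add: phi_def g'_def power2_eq_square)
    then have "ennreal ((phi s x / x)\<^sup>2) = ennreal (exp (-s)) * ennreal (g' x)"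
      by (simp add: ennreal_mult' del: times_divide_eq_right)
    then show "ennreal (exp (-s)) * (h (phi s x) * ennreal (g' x) * indicator {0..1} x)
      = ennreal ((phi s x / x)\<^sup>2) * h (phi s x) * indicator {0<..<1} x"
      using x by (auto simp: indicator_def mult_ac)
  qed
  finally show ?thesis ..
qed

lemma sqnorm_weighted_comp:
  assumes [measurable]: "F \<in> borel_measurable borel"
  shows "sqnorm (weighted_comp s F) = ennreal (exp (-s)) * sqnorm F"
proof -
  have "sqnorm (weighted_comp s F) =
    (\<integral>\<^sup>+x\<in>{0<..<1}. ennreal ((phi s x / x)\<^sup>2) * ennreal ((cmod (F (phi s x)))\<^sup>2) \<partial>lborel)"
    unfolding sqnorm_def weighted_comp_def
    by (simp only: norm_mult norm_of_real power_mult_distrib power2_abs ennreal_mult' zero_le_power2)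
  also have "\<dots> = ennreal (exp (-s)) * sqnorm F"
    unfolding sqnorm_def by (rule nn_integral_weighted_phi) measurable
  finally show ?thesis .
qed

lemma sqnorm_add_le:
  assumes [measurable]: "f \<in> borel_measurable borel" "g \<in> borel_measurable borel"
  shows "sqnorm (\<lambda>x. f x + g x) \<le> 2 * sqnorm f + 2 * sqnorm g"
proof -
  have *: "ennreal ((cmod (a + b))\<^sup>2) \<le> 2 * ennreal ((cmod a)\<^sup>2) + 2 * ennreal ((cmod b)\<^sup>2)" for a b
  proof -
    have "(cmod (a + b))\<^sup>2 \<le> (cmod a + cmod b)\<^sup>2"
      by (intro power_mono norm_triangle_ineq) auto
    also have "\<dots> \<le> 2 * (cmod a)\<^sup>2 + 2 * (cmod b)\<^sup>2"
      using sum_squares_bound[of "cmod a" "cmod b"] by (simp add: power2_sum)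
    finally have "ennreal ((cmod (a + b))\<^sup>2) \<le> ennreal (2 * (cmod a)\<^sup>2 + 2 * (cmod b)\<^sup>2)"
      by (rule ennreal_leI)
    then show ?thesis by (simp add: ennreal_plus ennreal_mult')
  qed
  have "sqnorm (\<lambda>x. f x + g x) \<le> (\<integral>\<^sup>+x. 2 * (ennreal ((cmod (f x))\<^sup>2) * indicator {0<..<1} x)
        + 2 * (ennreal ((cmod (g x))\<^sup>2) * indicator {0<..<1} x) \<partial>lborel)"
    unfolding sqnorm_def
    by (rule nn_integral_mono) (use * in \<open>auto simp: indicator_def\<close>)
  also have "\<dots> = 2 * sqnorm f + 2 * sqnorm g"
    unfolding sqnorm_def by (simp add: nn_integral_add nn_integral_cmult)
  finally show ?thesis .
qed

lemma sqnorm_uminus [simp]: "sqnorm (\<lambda>x. - f x) = sqnorm f"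
  by (simp add: sqnorm_def)

lemma sqnorm_diff_le:
  assumes [measurable]: "f \<in> borel_measurable borel" "g \<in> borel_measurable borel"
  shows "sqnorm (\<lambda>x. f x - g x) \<le> 2 * sqnorm f + 2 * sqnorm g"
  using sqnorm_add_le[of f "\<lambda>x. - g x"] by simp

lemma sqnorm_cmult: 
  assumes [measurable]: "f \<in> borel_measurable borel"
  shows "sqnorm (\<lambda>x. c * f x) = ennreal ((cmod c)\<^sup>2) * sqnorm f"
  unfolding sqnorm_def 
  by (subst nn_integral_cmult[symmetric]) (auto simp: norm_mult power_mult_distrib ennreal_mult' mult_ac intro!: nn_integral_cong)

section \<open>Square norms of integrals over time\<close>

lemma nn_integral_exp_decay:
  assumes "0 < c"
  shows "(\<integral>\<^sup>+s\<in>{0..}. ennreal (exp (- c * s)) \<partial>lborel) = ennreal (1 / c)"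
proof -
  have "((\<lambda>s::real. - (1 / c) * exp (- c * s)) \<longlongrightarrow> - (1 / c) * 0) at_top"
    using assms
    by (intro tendsto_intros exp_at_bot[THEN filterlim_compose] filterlim_tendsto_neg_mult_at_bot[OF tendsto_const _ filterlim_ident]) auto
  then have "(\<integral>\<^sup>+s. ennreal (exp (- c * s)) * indicator {0..} s \<partial>lborel) = ennreal (0 - - (1 / c) * exp (- c * 0))"
    using assms
    by (intro nn_integral_FTC_atLeast) (auto intro!: derivative_eq_intros simp: field_simps)
  then show ?thesis by simp
qed

text \<open>
  A function that is not integrable has Bochner integral \<open>0\<close> by convention.
\<close>

lemma norm_lebesgue_integral_le_nn_integral:
  fixes f :: "'a \<Rightarrow> 'b::{banach, second_countable_topology}"
  shows "ennreal (norm (integral\<^sup>L N f)) \<le> (\<integral>\<^sup>+x. ennreal (norm (f x)) \<partial>N)"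
  by (cases "integrable N f") (auto simp: integral_norm_bound_ennreal not_integrable_integral_eq)

text \<open>
  Split the integrand as \<open>exp (- s / 16)\<close> times \<open>exp (s / 16) * \<bar>D s x\<bar>\<close>, apply the Cauchy-Schwarz
  inequality in \<open>s\<close>, and exchange the integrals; the factor \<open>8\<close> is \<open>\<integral>\<^sub>0\<^sup>\<infinity> exp (- s / 8) ds\<close>. Any small positive
  exponent would do in place of \<open>1 / 8\<close>: it only has to leave room below the decay rate
  \<open>exp (- s / 4)\<close> that the later estimates provide.
\<close>

lemma nn_integral_square_of_time_integral_le:
  fixes D :: "real \<Rightarrow> real \<Rightarrow> complex"
  assumes [measurable]: "case_prod D \<in> borel_measurable (borel \<Otimes>\<^sub>M borel)"
  shows "(\<integral>\<^sup>+x\<in>{0<..<1}. (\<integral>\<^sup>+s\<in>{0..}. ennreal (cmod (D s x)) \<partial>lborel)\<^sup>2 \<partial>lborel)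
    \<le> 8 * (\<integral>\<^sup>+s\<in>{0..}. ennreal (exp (s / 8)) * sqnorm (D s) \<partial>lborel)"
proof -
  have exp1: "(exp (- (s / 16)))\<^sup>2 = exp (- (s / 8))" "(exp (s / 16))\<^sup>2 = exp (s / 8)" for s :: real
    by (simp_all add: power2_eq_square exp_add[symmetric])
  have pointwise: "(\<integral>\<^sup>+s\<in>{0..}. ennreal (cmod (D s x)) \<partial>lborel)\<^sup>2
    \<le> 8 * (\<integral>\<^sup>+s\<in>{0..}. ennreal (exp (s / 8) * (cmod (D s x))\<^sup>2) \<partial>lborel)" for x
  proof -
    let ?f = "\<lambda>s. ennreal (exp (- (s / 16))) * indicator {0..} s"
    let ?g = "\<lambda>s. ennreal (exp (s / 16) * cmod (D s x)) * indicator {0..} s"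
    have "(\<integral>\<^sup>+s\<in>{0..}. ennreal (cmod (D s x)) \<partial>lborel) = (\<integral>\<^sup>+s. ?f s * ?g s \<partial>lborel)"
      by (intro nn_integral_cong) (auto simp: indicator_def ennreal_mult'[symmetric] exp_minus)
    then have "(\<integral>\<^sup>+s\<in>{0..}. ennreal (cmod (D s x)) \<partial>lborel)\<^sup>2 = (\<integral>\<^sup>+s. ?f s * ?g s \<partial>lborel)\<^sup>2"
      by (rule arg_cong)
    also have "\<dots> \<le> (\<integral>\<^sup>+s. (?f s)\<^sup>2 \<partial>lborel) * (\<integral>\<^sup>+s. (?g s)\<^sup>2 \<partial>lborel)"
      by (rule Cauchy_Schwarz_nn_integral) measurable
    also have "(\<integral>\<^sup>+s. (?f s)\<^sup>2 \<partial>lborel) = (\<integral>\<^sup>+s\<in>{0..}. ennreal (exp (- (1 / 8) * s)) \<partial>lborel)"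
      by (intro nn_integral_cong) (auto simp: indicator_def ennreal_power exp1)
    also have "\<dots> = 8"
      by (subst nn_integral_exp_decay) auto
    also have "(\<integral>\<^sup>+s. (?g s)\<^sup>2 \<partial>lborel) = (\<integral>\<^sup>+s\<in>{0..}. ennreal (exp (s / 8) * (cmod (D s x))\<^sup>2) \<partial>lborel)"
      by (intro nn_integral_cong) (auto simp: indicator_def ennreal_power exp1 power_mult_distrib)
    finally show ?thesis .
  qed
  have "(\<integral>\<^sup>+x\<in>{0<..<1}. (\<integral>\<^sup>+s\<in>{0..}. ennreal (cmod (D s x)) \<partial>lborel)\<^sup>2 \<partial>lborel)
    \<le> (\<integral>\<^sup>+x. 8 * (\<integral>\<^sup>+s\<in>{0..}. ennreal (exp (s / 8) * (cmod (D s x))\<^sup>2) \<partial>lborel) * indicator {0<..<1} x \<partial>lborel)"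
    by (intro nn_integral_mono mult_right_mono pointwise) auto
  also have "\<dots> = 8 * (\<integral>\<^sup>+x. (\<integral>\<^sup>+s. ennreal (exp (s / 8) * (cmod (D s x))\<^sup>2) * indicator {0..} s * indicator {0<..<1} x \<partial>lborel) \<partial>lborel)"
  proof -
    have "(\<integral>\<^sup>+s. ennreal (exp (s / 8) * (cmod (D s x))\<^sup>2) * indicator {0..} s * indicator {0<..<1} x \<partial>lborel)
      = (\<integral>\<^sup>+s\<in>{0..}. ennreal (exp (s / 8) * (cmod (D s x))\<^sup>2) \<partial>lborel) * indicator {0<..<1} x" for x
      by (rule nn_integral_multc) measurable
    then show ?thesis
      by (simp only: mult.assoc[of 8]) (rule nn_integral_cmult, measurable)
  qed
  also have "(\<integral>\<^sup>+x. (\<integral>\<^sup>+s. ennreal (exp (s / 8) * (cmod (D s x))\<^sup>2) * indicator {0..} s * indicator {0<..<1} x \<partial>lborel) \<partial>lborel)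
    = (\<integral>\<^sup>+s. (\<integral>\<^sup>+x. ennreal (exp (s / 8) * (cmod (D s x))\<^sup>2) * indicator {0..} s * indicator {0<..<1} x \<partial>lborel) \<partial>lborel)"
    by (rule lborel_pair.Fubini') measurable
  also have "\<dots> = (\<integral>\<^sup>+s\<in>{0..}. ennreal (exp (s / 8)) * sqnorm (D s) \<partial>lborel)"
  proof (rule nn_integral_cong)
    fix s :: real
    have "(\<integral>\<^sup>+x. ennreal (exp (s / 8) * (cmod (D s x))\<^sup>2) * indicator {0..} s * indicator {0<..<1} x \<partial>lborel)
      = (\<integral>\<^sup>+x. (ennreal (exp (s / 8)) * indicator {0..} s) * (ennreal ((cmod (D s x))\<^sup>2) * indicator {0<..<1} x) \<partial>lborel)"
      by (simp add: ennreal_mult' mult_ac)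
    also have "\<dots> = ennreal (exp (s / 8)) * indicator {0..} s * sqnorm (D s)"
      unfolding sqnorm_def by (rule nn_integral_cmult) measurable
    finally show "(\<integral>\<^sup>+x. ennreal (exp (s / 8) * (cmod (D s x))\<^sup>2) * indicator {0..} s * indicator {0<..<1} x \<partial>lborel)
      = ennreal (exp (s / 8)) * sqnorm (D s) * indicator {0..} s"
      by (simp add: mult_ac)
  qed
  finally show ?thesis .
qed

lemma sqnorm_time_integral_le:
  fixes D :: "real \<Rightarrow> real \<Rightarrow> complex"
  assumes [measurable]: "case_prod D \<in> borel_measurable (borel \<Otimes>\<^sub>M borel)"
  shows "sqnorm (\<lambda>x. LINT s:{0..}|lborel. D s x)
    \<le> 8 * (\<integral>\<^sup>+s\<in>{0..}. ennreal (exp (s / 8)) * sqnorm (D s) \<partial>lborel)"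
proof -
  have "ennreal ((cmod (LINT s:{0..}|lborel. D s x))\<^sup>2) \<le> (\<integral>\<^sup>+s\<in>{0..}. ennreal (cmod (D s x)) \<partial>lborel)\<^sup>2" for x
  proof -
    have "ennreal (cmod (LINT s:{0..}|lborel. D s x)) \<le> (\<integral>\<^sup>+s. ennreal (norm (indicator {0..} s *\<^sub>R D s x)) \<partial>lborel)"
      unfolding set_lebesgue_integral_def by (rule norm_lebesgue_integral_le_nn_integral)
    also have "\<dots> = (\<integral>\<^sup>+s\<in>{0..}. ennreal (cmod (D s x)) \<partial>lborel)"
      by (intro nn_integral_cong) (auto simp: indicator_def)
    finally show ?thesis
      by (subst ennreal_power[symmetric]) (auto intro: power_mono)
  qed
  then have "sqnorm (\<lambda>x. LINT s:{0..}|lborel. D s x)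
     \<le> (\<integral>\<^sup>+x\<in>{0<..<1}. (\<integral>\<^sup>+s\<in>{0..}. ennreal (cmod (D s x)) \<partial>lborel)\<^sup>2 \<partial>lborel)"
    unfolding sqnorm_def by (intro nn_integral_mono mult_right_mono) auto
  also note nn_integral_square_of_time_integral_le[OF assms]
  finally show ?thesis .
qed

lemma nn_integral_exp_weight_le:
  assumes bound: "\<And>s. 0 \<le> s \<Longrightarrow> v s \<le> B * ennreal (exp (- (s / 4)))"
  shows "(\<integral>\<^sup>+s\<in>{0..}. ennreal (exp (s / 8)) * v s \<partial>lborel) \<le> 8 * B"
proof -
  have "ennreal (exp (s / 8)) * v s \<le> B * ennreal (exp (- (1 / 8) * s))" if "0 \<le> s" for s
  proof -
    have "ennreal (exp (s / 8)) * v s \<le> ennreal (exp (s / 8)) * (B * ennreal (exp (- (s / 4))))"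
      by (intro mult_left_mono bound that) auto
    also have "\<dots> = B * (ennreal (exp (s / 8)) * ennreal (exp (- (s / 4))))"
      by (simp add: mult_ac)
    also have "ennreal (exp (s / 8)) * ennreal (exp (- (s / 4))) = ennreal (exp (- (1 / 8) * s))"
      by (subst ennreal_mult[symmetric]) (auto simp: exp_add[symmetric])
    finally show ?thesis .
  qed
  then have "(\<integral>\<^sup>+s\<in>{0..}. ennreal (exp (s / 8)) * v s \<partial>lborel)
     \<le> (\<integral>\<^sup>+s. B * (ennreal (exp (- (1 / 8) * s)) * indicator {0..} s) \<partial>lborel)"
    by (intro nn_integral_mono) (auto simp: indicator_def)
  also have "\<dots> = B * (\<integral>\<^sup>+s\<in>{0..}. ennreal (exp (- (1 / 8) * s)) \<partial>lborel)"
    by (rule nn_integral_cmult) measurable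
  also have "\<dots> = 8 * B"
    by (subst nn_integral_exp_decay) (auto simp: mult.commute)
  finally show ?thesis .
qed

text \<open>
  The bound on the square norms makes the integral of \<open>\<bar>D s x\<bar>\<close> over \<open>s\<close> a square integrable
  function of \<open>x\<close>, hence a finite one for almost every \<open>x\<close>. The Bochner integral is therefore additive in \<open>D\<close>
  at almost every point.
\<close>

lemma AE_time_integrable:
  fixes D :: "real \<Rightarrow> real \<Rightarrow> complex"
  assumes [measurable]: "case_prod D \<in> borel_measurable (borel \<Otimes>\<^sub>M borel)"
    and bound: "\<And>s. 0 \<le> s \<Longrightarrow> sqnorm (D s) \<le> B * ennreal (exp (- (s / 4)))"
    and "B < \<infinity>"
  shows "AE x in lborel. x \<in> {0<..<1} \<longrightarrow> set_integrable lborel {0..} (\<lambda>s. D s x)"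
proof -
  let ?P = "\<lambda>x. (\<integral>\<^sup>+s\<in>{0..}. ennreal (cmod (D s x)) \<partial>lborel)"
  have "(\<integral>\<^sup>+x\<in>{0<..<1}. (?P x)\<^sup>2 \<partial>lborel) \<le> 8 * (8 * B)"
    by (rule order_trans[OF nn_integral_square_of_time_integral_le[OF assms(1)]])
      (intro mult_left_mono nn_integral_exp_weight_le bound; simp)
  also have "\<dots> < \<infinity>"
    using \<open>B < \<infinity>\<close> by (simp add: ennreal_mult_less_top)
  finally have "AE x in lborel. (?P x)\<^sup>2 * indicator {0<..<1} x \<noteq> \<infinity>"
    by (intro nn_integral_PInf_AE) auto
  then show ?thesis
  proof eventually_elim
    fix x assume *: "(?P x)\<^sup>2 * indicator {0<..<1} x \<noteq> \<infinity>"
    show "x \<in> {0<..<1} \<longrightarrow> set_integrable lborel {0..} (\<lambda>s. D s x)"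
    proof
      assume "x \<in> {0<..<1}"
      with * have "?P x < \<infinity>"
        by (auto simp: less_top[symmetric])
      moreover have "?P x = (\<integral>\<^sup>+s. ennreal (norm (indicator {0..} s *\<^sub>R D s x)) \<partial>lborel)"
        by (intro nn_integral_cong) (auto simp: indicator_def)
      ultimately show "set_integrable lborel {0..} (\<lambda>s. D s x)"
        unfolding set_integrable_def by (intro integrableI_bounded) auto
    qed
  qed
qed

lemma measurable_sqnorm [measurable]:
  assumes [measurable]: "case_prod D \<in> borel_measurable (borel \<Otimes>\<^sub>M borel)"
  shows "(\<lambda>s. sqnorm (D s)) \<in> borel_measurable borel"
  unfolding sqnorm_def by measurable

text \<open>
  Dominated convergence for integrals with values in \<open>L\<^sup>2(0,1)\<close>. Every limit of integrals over time
  taken below is an instance of it.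
\<close>

lemma sqnorm_time_integral_tendsto_0:
  fixes D :: "nat \<Rightarrow> real \<Rightarrow> real \<Rightarrow> complex"
  assumes meas [measurable]: "\<And>n. case_prod (D n) \<in> borel_measurable (borel \<Otimes>\<^sub>M borel)"
    and bound: "\<And>n s. 0 \<le> s \<Longrightarrow> sqnorm (D n s) \<le> B * ennreal (exp (- (s / 4)))"
    and "B < \<infinity>"
    and lim: "\<And>s. 0 \<le> s \<Longrightarrow> (\<lambda>n. sqnorm (D n s)) \<longlonglongrightarrow> 0"
  shows "(\<lambda>n. sqnorm (\<lambda>x. LINT s:{0..}|lborel. D n s x)) \<longlonglongrightarrow> 0"
proof -
  have m [measurable]: "(\<lambda>s. sqnorm (D n s)) \<in> borel_measurable borel" for n
    by (rule measurable_sqnorm) (rule meas)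
  have "(\<lambda>n. (\<integral>\<^sup>+s\<in>{0..}. ennreal (exp (s / 8)) * sqnorm (D n s) \<partial>lborel)) \<longlonglongrightarrow> (\<integral>\<^sup>+(s::real). 0 \<partial>lborel)"
  proof (rule nn_integral_dominated_convergence)
    let ?w = "\<lambda>s. ennreal (exp (s / 8)) * (B * ennreal (exp (- (s / 4)))) * indicator {0..} s"
    show "AE s in lborel. ennreal (exp (s / 8)) * sqnorm (D n s) * indicator {0..} s \<le> ?w s" for n
      by (rule AE_I2) (auto simp: indicator_def intro!: mult_left_mono bound)
    have "(\<integral>\<^sup>+s. ?w s \<partial>lborel) \<le> 8 * B"
      by (rule nn_integral_exp_weight_le) simp
    then show "(\<integral>\<^sup>+s. ?w s \<partial>lborel) < \<infinity>"
      using \<open>B < \<infinity>\<close> by (simp add: ennreal_mult_less_top le_less_trans)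
    have "(\<lambda>n. ennreal (exp (s / 8)) * sqnorm (D n s) * indicator {0..} s) \<longlonglongrightarrow> 0" for s
    proof (cases "0 \<le> s")
      case True
      then show ?thesis
        using ennreal_tendsto_cmult[OF _ lim[OF True], of "ennreal (exp (s / 8))"] by simp
    qed simp
    then show "AE s in lborel. (\<lambda>n. ennreal (exp (s / 8)) * sqnorm (D n s) * indicator {0..} s) \<longlonglongrightarrow> 0"
      by simp
  qed measurable
  then have "(\<lambda>n. 8 * (\<integral>\<^sup>+s\<in>{0..}. ennreal (exp (s / 8)) * sqnorm (D n s) \<partial>lborel)) \<longlonglongrightarrow> 0"
    using ennreal_tendsto_cmult[of 8 _ 0] by simp
  then show ?thesis
    by (rule tendsto_sandwich[OF _ _ tendsto_const, rotated 2])
      (auto intro!: always_eventually sqnorm_time_integral_le meas)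
qed

section \<open>Strong continuity of the semigroup\<close>

text \<open>
  The retraction of the plane onto the disc of radius \<open>K\<close>. It makes a function bounded without
  destroying measurability or continuity.
\<close>

definition clamp_norm :: "real \<Rightarrow> complex \<Rightarrow> complex"
  where "clamp_norm K z = complex_of_real (K / max K (cmod z)) * z"

lemma continuous_on_clamp_norm:
  assumes "0 < K" shows "continuous_on A (clamp_norm K)"
proof -
  have "max K (cmod z) \<noteq> 0" for z using assms by (metis max.cobounded1 not_le)
  then show ?thesis unfolding clamp_norm_def by (intro continuous_intros) auto
qed

lemma cmod_clamp_norm_le:
  assumes "0 < K" shows "cmod (clamp_norm K z) \<le> K"
proof -
  have "K * cmod z \<le> K * max K (cmod z)"
    using assms by (intro mult_left_mono) auto
  then show ?thesis
    using assms by (simp add: clamp_norm_def norm_mult norm_divide max_def field_simps split: if_splits)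
qed

lemma clamp_norm_eq: "0 < K \<Longrightarrow> cmod z \<le> K \<Longrightarrow> clamp_norm K z = z"
  by (simp add: clamp_norm_def max_def)

lemma cmod_diff_clamp_norm_le:
  assumes "0 < K" shows "cmod (z - clamp_norm K z) \<le> cmod z"
proof -
  define q where "q = K / max K (cmod z)"
  have q: "0 \<le> q" "q \<le> 1" using assms by (auto simp: q_def max_def divide_simps)
  have "z - clamp_norm K z = complex_of_real (1 - q) * z"
    by (simp add: clamp_norm_def q_def algebra_simps)
  then have "cmod (z - clamp_norm K z) = (1 - q) * cmod z"
    using q by (simp only: norm_mult norm_of_real)
  also have "\<dots> \<le> 1 * cmod z"
    using q by (intro mult_right_mono) auto
  finally show ?thesis by simp
qed

lemma sqnorm_tendsto_0:
  fixes f :: "nat \<Rightarrow> real \<Rightarrow> complex"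
  assumes [measurable]: "\<And>n. f n \<in> borel_measurable borel" "w \<in> borel_measurable borel"
    and bound: "\<And>n x. x \<in> {0<..<1} \<Longrightarrow> ennreal ((cmod (f n x))\<^sup>2) \<le> w x"
    and fin: "(\<integral>\<^sup>+x\<in>{0<..<1}. w x \<partial>lborel) < \<infinity>"
    and lim: "AE x in lborel. x \<in> {0<..<1} \<longrightarrow> (\<lambda>n. f n x) \<longlonglongrightarrow> 0"
  shows "(\<lambda>n. sqnorm (f n)) \<longlonglongrightarrow> 0"
proof -
  have "(\<lambda>n. sqnorm (f n)) \<longlonglongrightarrow> (\<integral>\<^sup>+(x::real). 0 \<partial>lborel)"
    unfolding sqnorm_def
  proof (rule nn_integral_dominated_convergence[OF _ _ _ _ fin])
    show "AE x in lborel. ennreal ((cmod (f n x))\<^sup>2) * indicator {0<..<1} x \<le> w x * indicator {0<..<1} x" for n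
      by (rule AE_I2) (use bound in \<open>auto simp: indicator_def\<close>)
    show "AE x in lborel. (\<lambda>n. ennreal ((cmod (f n x))\<^sup>2) * indicator {0<..<1} x) \<longlonglongrightarrow> 0"
      using lim
    proof eventually_elim
      fix x assume x: "x \<in> {0<..<1} \<longrightarrow> (\<lambda>n. f n x) \<longlonglongrightarrow> 0"
      show "(\<lambda>n. ennreal ((cmod (f n x))\<^sup>2) * indicator {0<..<1} x) \<longlonglongrightarrow> 0"
      proof (cases "x \<in> {0<..<1}")
        case True
        then have "(\<lambda>n. (cmod (f n x))\<^sup>2) \<longlonglongrightarrow> 0"
          using x tendsto_power[OF tendsto_norm_zero, of _ sequentially 2] by fastforce
        then show ?thesis using True by (simp add: ennreal_tendsto_0_iff)
      qed simp
    qed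
  qed measurable
  then show ?thesis by simp
qed

text \<open>
  Bounded continuous functions are dense: cut \<open>F\<close> off at a large radius, use that a measurable
  function is almost everywhere the limit of continuous ones, and cut these off at the same radius,
  so that dominated convergence applies on the finite interval.
\<close>

lemma sqnorm_approx_continuous_bounded:
  assumes F [measurable]: "F \<in> borel_measurable borel" and fin: "sqnorm F < \<infinity>" and "0 < \<epsilon>"
  obtains g K where "continuous_on UNIV g" "\<And>x. cmod (g x) \<le> K" "sqnorm (\<lambda>x. F x - g x) < \<epsilon>"
proof -
  have "0 < \<epsilon> / 4" using \<open>0 < \<epsilon>\<close> by (simp add: ennreal_zero_less_divide)
  have cm [measurable]: "clamp_norm (real (Suc n)) \<in> borel_measurable borel" for n
    by (intro borel_measurable_continuous_onI continuous_on_clamp_norm) simp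
  have "(\<lambda>n. sqnorm (\<lambda>x. F x - clamp_norm (real (Suc n)) (F x))) \<longlonglongrightarrow> 0"
  proof (rule sqnorm_tendsto_0)
    show "ennreal ((cmod (F x - clamp_norm (real (Suc n)) (F x)))\<^sup>2) \<le> ennreal ((cmod (F x))\<^sup>2)" for n x
      by (intro ennreal_leI power_mono cmod_diff_clamp_norm_le) auto
    show "(\<integral>\<^sup>+x\<in>{0<..<1}. ennreal ((cmod (F x))\<^sup>2) \<partial>lborel) < \<infinity>"
      using fin by (simp add: sqnorm_def)
    have "(\<lambda>n. F x - clamp_norm (real (Suc n)) (F x)) \<longlonglongrightarrow> 0" for x
    proof (rule tendsto_eventually)
      obtain N where "cmod (F x) \<le> real N" using real_arch_simple by blast
      then show "\<forall>\<^sub>F n in sequentially. F x - clamp_norm (real (Suc n)) (F x) = 0"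
        by (intro eventually_sequentiallyI[of N]) (simp add: clamp_norm_eq)
    qed
    then show "AE x in lborel. x \<in> {0<..<1} \<longrightarrow> (\<lambda>n. F x - clamp_norm (real (Suc n)) (F x)) \<longlonglongrightarrow> 0"
      by simp
  qed measurable
  from order_tendstoD(2)[OF this \<open>0 < \<epsilon> / 4\<close>]
  obtain m where m: "sqnorm (\<lambda>x. F x - clamp_norm (real (Suc m)) (F x)) < \<epsilon> / 4"
    by (auto simp: eventually_sequentially)
  define K where "K = real (Suc m)"
  have K: "0 < K" by (simp add: K_def)
  have [measurable]: "clamp_norm K \<in> borel_measurable borel" by (simp only: K_def cm)
  have "F measurable_on UNIV"
    by (rule lebesgue_measurable_imp_measurable_on) (auto intro: measurable_completion)
  then obtain N g where N: "negligible N" and g: "\<And>n. continuous_on UNIV (g n)"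
    and gF: "\<And>x. x \<notin> N \<Longrightarrow> (\<lambda>n. g n x) \<longlonglongrightarrow> F x"
    by (auto simp: measurable_on_def)
  have [measurable]: "g n \<in> borel_measurable borel" for n
    using g by (rule borel_measurable_continuous_onI)
  have "(\<lambda>n. sqnorm (\<lambda>x. clamp_norm K (F x) - clamp_norm K (g n x))) \<longlonglongrightarrow> 0"
  proof (rule sqnorm_tendsto_0)
    fix n x
    have "cmod (clamp_norm K (F x) - clamp_norm K (g n x)) \<le> K + K"
      by (rule order_trans[OF norm_triangle_ineq4 add_mono[OF cmod_clamp_norm_le cmod_clamp_norm_le]]) (rule K)+
    then show "ennreal ((cmod (clamp_norm K (F x) - clamp_norm K (g n x)))\<^sup>2) \<le> ennreal ((K + K)\<^sup>2)"
      by (intro ennreal_leI power_mono) auto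
  next
    show "(\<integral>\<^sup>+(x::real)\<in>{0<..<1}. ennreal ((K + K)\<^sup>2) \<partial>lborel) < \<infinity>"
      by (subst nn_integral_cmult_indicator) (auto simp: ennreal_mult_less_top)
    have "AE x in lebesgue. x \<notin> N"
      using N by (simp add: negligible_iff_null_sets AE_not_in)
    then have "AE x in lborel. x \<notin> N"
      by (simp add: AE_completion_iff)
    then show "AE x in lborel. x \<in> {0<..<1} \<longrightarrow> (\<lambda>n. clamp_norm K (F x) - clamp_norm K (g n x)) \<longlonglongrightarrow> 0"
    proof eventually_elim
      fix x assume "x \<notin> N"
      have "isCont (clamp_norm K) (F x)"
        using continuous_on_clamp_norm[OF K, of UNIV] by (simp add: continuous_on_eq_continuous_at)
      then have "(\<lambda>n. clamp_norm K (g n x)) \<longlonglongrightarrow> clamp_norm K (F x)"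
        using gF[OF \<open>x \<notin> N\<close>] by (rule isCont_tendsto_compose)
      from tendsto_diff[OF tendsto_const this, of "clamp_norm K (F x)"]
      show "x \<in> {0<..<1} \<longrightarrow> (\<lambda>n. clamp_norm K (F x) - clamp_norm K (g n x)) \<longlonglongrightarrow> 0"
        by simp
    qed
  qed measurable
  from order_tendstoD(2)[OF this \<open>0 < \<epsilon> / 4\<close>]
  obtain n where n: "sqnorm (\<lambda>x. clamp_norm K (F x) - clamp_norm K (g n x)) < \<epsilon> / 4"
    by (auto simp: eventually_sequentially)
  show thesis
  proof (rule that)
    show "continuous_on UNIV (\<lambda>x. clamp_norm K (g n x))"
      using continuous_on_compose2[OF continuous_on_clamp_norm[OF K] g subset_UNIV] .
    show "cmod (clamp_norm K (g n x)) \<le> K" for x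
      by (rule cmod_clamp_norm_le[OF K])
    have "sqnorm (\<lambda>x. F x - clamp_norm K (g n x))
      = sqnorm (\<lambda>x. (F x - clamp_norm K (F x)) + (clamp_norm K (F x) - clamp_norm K (g n x)))"
      by simp
    also have "\<dots> \<le> 2 * sqnorm (\<lambda>x. F x - clamp_norm K (F x)) + 2 * sqnorm (\<lambda>x. clamp_norm K (F x) - clamp_norm K (g n x))"
      by (rule sqnorm_add_le) measurable
    also have "\<dots> < 2 * (\<epsilon> / 4) + 2 * (\<epsilon> / 4)"
      using m n unfolding K_def[symmetric]
      by (intro add_strict_mono ennreal_mult_strict_left_mono) auto
    also have "\<dots> \<le> \<epsilon>"
      by (cases \<epsilon>) (auto simp: ennreal_numeral[symmetric] ennreal_mult[symmetric] divide_ennreal ennreal_plus[symmetric] simp del: ennreal_numeral ennreal_plus)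
    finally show "sqnorm (\<lambda>x. F x - clamp_norm K (g n x)) < \<epsilon>" .
  qed
qed

lemma weighted_comp_diff: "weighted_comp s (\<lambda>x. f x - g x) x = weighted_comp s f x - weighted_comp s g x"
  by (simp add: weighted_comp_def algebra_simps)

lemma sqnorm_weighted_comp_le:
  assumes "F \<in> borel_measurable borel" "0 \<le> s"
  shows "sqnorm (weighted_comp s F) \<le> sqnorm F"
proof -
  have "ennreal (exp (-s)) * sqnorm F \<le> 1 * sqnorm F"
    using assms(2) by (intro mult_right_mono) auto
  then show ?thesis by (simp add: sqnorm_weighted_comp[OF assms(1)])
qed

lemma weighted_comp_tendsto_bounded:
  assumes g: "continuous_on UNIV g" and K: "\<And>x. cmod (g x) \<le> K"
    and r: "\<And>n. 0 \<le> r n" "r \<longlonglongrightarrow> s" "0 \<le> s"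
  shows "(\<lambda>n. sqnorm (\<lambda>x. weighted_comp (r n) g x - weighted_comp s g x)) \<longlonglongrightarrow> 0"
proof (rule sqnorm_tendsto_0)
  have [measurable]: "g \<in> borel_measurable borel"
    using g by (rule borel_measurable_continuous_onI)
  show "(\<lambda>x. weighted_comp (r n) g x - weighted_comp s g x) \<in> borel_measurable borel" for n
    by measurable
  have bd: "cmod (weighted_comp u g x) \<le> K" if "0 \<le> u" "x \<in> {0<..<1}" for u x
  proof -
    have "0 \<le> phi u x / x" "phi u x / x \<le> 1"
      using that phi_pos[of x u] phi_le[of x u] by auto
    then have "\<bar>phi u x / x\<bar> * cmod (g (phi u x)) \<le> 1 * K"
      using K[of "phi u x"] by (intro mult_mono) auto
    then show ?thesis by (simp only: weighted_comp_def norm_mult norm_of_real mult_1)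
  qed
  fix n and x :: real assume x: "x \<in> {0<..<1}"
  have "cmod (weighted_comp (r n) g x - weighted_comp s g x) \<le> K + K"
    by (rule order_trans[OF norm_triangle_ineq4 add_mono[OF bd bd]]) (use x r in auto)
  then show "ennreal ((cmod (weighted_comp (r n) g x - weighted_comp s g x))\<^sup>2) \<le> ennreal ((K + K)\<^sup>2)"
    by (intro ennreal_leI power_mono) auto
next
  show "(\<integral>\<^sup>+(x::real)\<in>{0<..<1}. ennreal ((K + K)\<^sup>2) \<partial>lborel) < \<infinity>"
    by (subst nn_integral_cmult_indicator) (auto simp: ennreal_mult_less_top)
  have "(\<lambda>n. weighted_comp (r n) g x - weighted_comp s g x) \<longlonglongrightarrow> 0" if x: "x \<in> {0<..<1}" for x
  proof -
    have "isCont g (phi s x)" using g by (simp add: continuous_on_eq_continuous_at)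
    moreover have phi: "(\<lambda>n. phi (r n) x) \<longlonglongrightarrow> phi s x"
      unfolding phi_def using phi_denominator_pos[of x s] x
      by (intro tendsto_intros r(2)) auto
    ultimately have "(\<lambda>n. g (phi (r n) x)) \<longlonglongrightarrow> g (phi s x)"
      by (rule isCont_tendsto_compose)
    with phi have "(\<lambda>n. weighted_comp (r n) g x - weighted_comp s g x) \<longlonglongrightarrow> weighted_comp s g x - weighted_comp s g x"
      unfolding weighted_comp_def using x by (intro tendsto_intros) auto
    then show ?thesis by simp
  qed
  then show "AE x in lborel. x \<in> {0<..<1} \<longrightarrow> (\<lambda>n. weighted_comp (r n) g x - weighted_comp s g x) \<longlonglongrightarrow> 0"
    by simp
qed simp

text \<open>
  For bounded continuous functions this is dominated convergence; the general case follows by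
  density because the operators are contractions.
\<close>

lemma weighted_comp_strongly_continuous:
  assumes F [measurable]: "F \<in> borel_measurable borel" and fin: "sqnorm F < \<infinity>"
    and r: "\<And>n. 0 \<le> r n" "r \<longlonglongrightarrow> s" "0 \<le> s"
  shows "(\<lambda>n. sqnorm (\<lambda>x. weighted_comp (r n) F x - weighted_comp s F x)) \<longlonglongrightarrow> 0"
proof (rule order_tendstoI)
  fix \<epsilon> :: ennreal assume "0 < \<epsilon>"
  then have \<epsilon>: "0 < \<epsilon> / 10" by (simp add: ennreal_zero_less_divide)
  \<comment> \<open>two applications of the inequality for sums cost the total factor \<open>2 + 4 + 4 = 10\<close>\<close>
  obtain g K where g: "continuous_on UNIV g" and K: "\<And>x. cmod (g x) \<le> K"
    and Fg: "sqnorm (\<lambda>x. F x - g x) < \<epsilon> / 10"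
    using sqnorm_approx_continuous_bounded[OF F fin \<epsilon>] by metis
  have [measurable]: "g \<in> borel_measurable borel"
    using g by (rule borel_measurable_continuous_onI)
  have "\<forall>\<^sub>F n in sequentially. sqnorm (\<lambda>x. weighted_comp (r n) g x - weighted_comp s g x) < \<epsilon> / 10"
    using weighted_comp_tendsto_bounded[OF g K r] \<epsilon> by (rule order_tendstoD)
  then show "\<forall>\<^sub>F n in sequentially. sqnorm (\<lambda>x. weighted_comp (r n) F x - weighted_comp s F x) < \<epsilon>"
  proof eventually_elim
    fix n assume n: "sqnorm (\<lambda>x. weighted_comp (r n) g x - weighted_comp s g x) < \<epsilon> / 10"
    let ?S = "\<lambda>u. weighted_comp u (\<lambda>x. F x - g x)"
    let ?d = "\<lambda>x. weighted_comp (r n) g x - weighted_comp s g x"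
    have S: "sqnorm (?S u) < \<epsilon> / 10" if "0 \<le> u" for u
      by (rule le_less_trans[OF sqnorm_weighted_comp_le Fg]) (use that in measurable)
    have "sqnorm (\<lambda>x. weighted_comp (r n) F x - weighted_comp s F x) = sqnorm (\<lambda>x. ?S (r n) x + (?d x - ?S s x))"
      by (simp add: weighted_comp_diff)
    also have "\<dots> \<le> 2 * sqnorm (?S (r n)) + 2 * sqnorm (\<lambda>x. ?d x - ?S s x)"
      by (rule sqnorm_add_le) measurable
    also have "\<dots> \<le> 2 * sqnorm (?S (r n)) + 2 * (2 * sqnorm ?d + 2 * sqnorm (?S s))"
      by (intro add_mono mult_left_mono sqnorm_diff_le) (simp_all, measurable)
    also have "\<dots> < 2 * (\<epsilon> / 10) + 2 * (2 * (\<epsilon> / 10) + 2 * (\<epsilon> / 10))"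
      using n S[OF r(1)] S[OF r(3)] by (intro add_strict_mono ennreal_mult_strict_left_mono) auto
    also have "\<dots> \<le> \<epsilon>"
      by (cases \<epsilon>) (auto simp: ennreal_numeral[symmetric] ennreal_mult[symmetric] divide_ennreal ennreal_plus[symmetric] simp del: ennreal_numeral ennreal_plus)
    finally show "sqnorm (\<lambda>x. weighted_comp (r n) F x - weighted_comp s F x) < \<epsilon>" .
  qed
qed simp

section \<open>Averages of the semigroup against a kernel\<close>

text \<open>
  The operator \<open>T\<^sub>k\<close> of the introduction. The integral is taken pointwise in \<open>x\<close> and has the value
  \<open>0\<close> where it diverges; for admissible kernels and square integrable \<open>F\<close> these \<open>x\<close> form a null set.
\<close>

definition time_average :: "(real \<Rightarrow> real) \<Rightarrow> (real \<Rightarrow> complex) \<Rightarrow> real \<Rightarrow> complex"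
  where "time_average k F x = (LINT s:{0..}|lborel. complex_of_real (k s) * weighted_comp s F x)"

text \<open>
  Since \<open>\<parallel>S\<^sub>s F\<parallel>\<^sup>2\<close> decays like \<open>exp (-s)\<close>, growth of \<open>k\<close> below \<open>exp (s / 2)\<close> makes \<open>T\<^sub>k\<close> bounded.
  The rate \<open>3 / 8\<close> lies between \<open>1 / 4\<close>, which the Taylor polynomials of \<open>exp (- s / 4)\<close> need,
  and \<open>1 / 2\<close>; it leaves the decay \<open>exp (- s / 4)\<close> for the square norm of the integrand.
\<close>

definition admissible_kernel :: "(real \<Rightarrow> real) \<Rightarrow> real \<Rightarrow> bool"
  where "admissible_kernel k B \<longleftrightarrow> k \<in> borel_measurable borel \<and> (\<forall>s\<ge>0. \<bar>k s\<bar> \<le> B * exp (3 * s / 8))"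

lemma measurable_set_lebesgue_integral_param [measurable]:
  fixes D :: "real \<Rightarrow> real \<Rightarrow> complex"
  assumes [measurable]: "case_prod D \<in> borel_measurable (borel \<Otimes>\<^sub>M borel)"
  shows "(\<lambda>x. LINT s:{0..}|lborel. D s x) \<in> borel_measurable borel"
  unfolding set_lebesgue_integral_def by measurable

lemma measurable_time_average [measurable]:
  assumes [measurable]: "k \<in> borel_measurable borel" "F \<in> borel_measurable borel"
  shows "time_average k F \<in> borel_measurable borel"
  unfolding time_average_def by measurable

lemma sqnorm_kernel_weighted_comp_le:
  assumes k: "admissible_kernel k B" and F [measurable]: "F \<in> borel_measurable borel" and "0 \<le> s"
  shows "sqnorm (\<lambda>x. complex_of_real (k s) * weighted_comp s F x)
    \<le> ennreal (B\<^sup>2) * sqnorm F * ennreal (exp (- (s / 4)))"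
proof -
  have "(k s)\<^sup>2 * exp (-s) \<le> B\<^sup>2 * exp (- (s / 4))"
  proof -
    have "\<bar>k s\<bar>\<^sup>2 \<le> (B * exp (3 * s / 8))\<^sup>2"
      using k \<open>0 \<le> s\<close> by (intro power_mono) (auto simp: admissible_kernel_def)
    then have "(k s)\<^sup>2 * exp (-s) \<le> (B * exp (3 * s / 8))\<^sup>2 * exp (-s)"
      by (intro mult_right_mono) auto
    also have "\<dots> = B\<^sup>2 * (exp (3 * s / 8) * exp (3 * s / 8) * exp (-s))"
      by (simp add: power2_eq_square mult_ac)
    also have "exp (3 * s / 8) * exp (3 * s / 8) * exp (-s) = exp (- (s / 4))"
      by (simp add: exp_add[symmetric])
    finally show ?thesis .
  qed
  then have "ennreal ((k s)\<^sup>2) * ennreal (exp (-s)) \<le> ennreal (B\<^sup>2) * ennreal (exp (- (s / 4)))"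
    by (simp add: ennreal_mult'[symmetric])
  then have "ennreal ((k s)\<^sup>2) * ennreal (exp (-s)) * sqnorm F \<le> ennreal (B\<^sup>2) * ennreal (exp (- (s / 4))) * sqnorm F"
    by (rule mult_right_mono) simp
  then show ?thesis
    by (subst sqnorm_cmult) (simp_all add: sqnorm_weighted_comp mult_ac)
qed

lemma AE_kernel_integrable:
  assumes k: "admissible_kernel k B" and F [measurable]: "F \<in> borel_measurable borel" and fin: "sqnorm F < \<infinity>"
  shows "AE x in lborel. x \<in> {0<..<1} \<longrightarrow> set_integrable lborel {0..} (\<lambda>s. complex_of_real (k s) * weighted_comp s F x)"
proof (rule AE_time_integrable)
  have [measurable]: "k \<in> borel_measurable borel" using k by (simp add: admissible_kernel_def)
  show "(\<lambda>(s, x). complex_of_real (k s) * weighted_comp s F x) \<in> borel_measurable (borel \<Otimes>\<^sub>M borel)"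
    by measurable
  show "ennreal (B\<^sup>2) * sqnorm F < \<infinity>"
    using fin by (simp add: ennreal_mult_less_top)
qed (rule sqnorm_kernel_weighted_comp_le[OF k F])

lemma sqnorm_time_average_finite:
  assumes k: "admissible_kernel k B" and F [measurable]: "F \<in> borel_measurable borel" and fin: "sqnorm F < \<infinity>"
  shows "sqnorm (time_average k F) < \<infinity>"
proof -
  have [measurable]: "k \<in> borel_measurable borel" using k by (simp add: admissible_kernel_def)
  have "sqnorm (time_average k F) \<le> 8 * (\<integral>\<^sup>+s\<in>{0..}. ennreal (exp (s / 8)) * sqnorm (\<lambda>x. complex_of_real (k s) * weighted_comp s F x) \<partial>lborel)"
    unfolding time_average_def by (rule sqnorm_time_integral_le) measurable
  also have "\<dots> \<le> 8 * (8 * (ennreal (B\<^sup>2) * sqnorm F))"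
    by (intro mult_left_mono nn_integral_exp_weight_le sqnorm_kernel_weighted_comp_le[OF k F]) auto
  also have "\<dots> < \<infinity>"
    using fin by (simp add: ennreal_mult_less_top)
  finally show ?thesis .
qed

lemma time_average_add:
  assumes k: "admissible_kernel k B" and l: "admissible_kernel l C"
    and F: "F \<in> borel_measurable borel" and fin: "sqnorm F < \<infinity>"
  shows "AE x in lborel. x \<in> {0<..<1} \<longrightarrow>
    time_average (\<lambda>s. k s + l s) F x = time_average k F x + time_average l F x"
  using AE_kernel_integrable[OF k F fin] AE_kernel_integrable[OF l F fin]
  by eventually_elim (simp add: time_average_def set_integral_add ring_distribs)

lemma time_average_cmult: "time_average (\<lambda>s. c * k s) F x = complex_of_real c * time_average k F x"
  by (simp add: time_average_def mult.assoc)

lemma time_average_diff: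
  assumes k: "admissible_kernel k B" and l: "admissible_kernel l C"
    and F: "F \<in> borel_measurable borel" and fin: "sqnorm F < \<infinity>"
  shows "AE x in lborel. x \<in> {0<..<1} \<longrightarrow>
    time_average (\<lambda>s. k s - l s) F x = time_average k F x - time_average l F x"
  using AE_kernel_integrable[OF k F fin] AE_kernel_integrable[OF l F fin]
  by eventually_elim (simp add: time_average_def set_integral_diff ring_distribs)

lemma sqnorm_cong_AE:
  assumes "AE x in lborel. x \<in> {0<..<1} \<longrightarrow> f x = g x"
  shows "sqnorm f = sqnorm g"
  unfolding sqnorm_def by (rule nn_integral_cong_AE) (use assms in \<open>eventually_elim, auto simp: indicator_def\<close>)

lemma admissible_kernel_diff:
  assumes "admissible_kernel k B" "admissible_kernel l C"
  shows "admissible_kernel (\<lambda>s. k s - l s) (B + C)"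
  unfolding admissible_kernel_def
proof (intro conjI allI impI)
  show "(\<lambda>s. k s - l s) \<in> borel_measurable borel"
    using assms by (auto simp: admissible_kernel_def)
  fix s :: real assume "0 \<le> s"
  then have "\<bar>k s\<bar> + \<bar>l s\<bar> \<le> B * exp (3 * s / 8) + C * exp (3 * s / 8)"
    using assms by (intro add_mono) (auto simp: admissible_kernel_def)
  then show "\<bar>k s - l s\<bar> \<le> (B + C) * exp (3 * s / 8)"
    by (simp add: algebra_simps)
qed

lemma time_average_tendsto:
  assumes k: "\<And>n. admissible_kernel (k n) B" and l: "admissible_kernel l B"
    and lim: "\<And>s. 0 \<le> s \<Longrightarrow> (\<lambda>n. k n s) \<longlonglongrightarrow> l s"
    and F [measurable]: "F \<in> borel_measurable borel" and fin: "sqnorm F < \<infinity>"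
  shows "(\<lambda>n. sqnorm (\<lambda>x. time_average (k n) F x - time_average l F x)) \<longlonglongrightarrow> 0"
proof -
  have [measurable]: "k n \<in> borel_measurable borel" "l \<in> borel_measurable borel" for n
    using k l by (auto simp: admissible_kernel_def)
  have adm: "admissible_kernel (\<lambda>s. k n s - l s) (B + B)" for n
    by (rule admissible_kernel_diff[OF k l])
  have "sqnorm (\<lambda>x. time_average (k n) F x - time_average l F x)
      = sqnorm (\<lambda>x. LINT s:{0..}|lborel. complex_of_real (k n s - l s) * weighted_comp s F x)" for n
    using time_average_diff[OF k[of n] l F fin]
    by (intro sqnorm_cong_AE) (auto elim!: eventually_mono simp: time_average_def)
  moreover have "(\<lambda>n. sqnorm (\<lambda>x. LINT s:{0..}|lborel. complex_of_real (k n s - l s) * weighted_comp s F x)) \<longlonglongrightarrow> 0"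
  proof (rule sqnorm_time_integral_tendsto_0)
    show "(\<lambda>(s, x). complex_of_real (k n s - l s) * weighted_comp s F x) \<in> borel_measurable (borel \<Otimes>\<^sub>M borel)" for n
      by measurable
    show "sqnorm (\<lambda>x. complex_of_real (k n s - l s) * weighted_comp s F x)
       \<le> ennreal ((B + B)\<^sup>2) * sqnorm F * ennreal (exp (- (s / 4)))" if "0 \<le> s" for n s
      by (rule sqnorm_kernel_weighted_comp_le[OF adm F that])
    show "ennreal ((B + B)\<^sup>2) * sqnorm F < \<infinity>"
      using fin by (simp add: ennreal_mult_less_top)
    fix s :: real assume "0 \<le> s"
    have "(\<lambda>n. (k n s - l s)\<^sup>2) \<longlonglongrightarrow> 0"
      using tendsto_power[OF tendsto_diff[OF lim[OF \<open>0 \<le> s\<close>] tendsto_const[of "l s"]], of 2] by simp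
    then have "(\<lambda>n. ennreal ((k n s - l s)\<^sup>2)) \<longlonglongrightarrow> 0"
      by (simp add: ennreal_tendsto_0_iff)
    then have "(\<lambda>n. sqnorm (weighted_comp s F) * ennreal ((k n s - l s)\<^sup>2)) \<longlonglongrightarrow> sqnorm (weighted_comp s F) * 0"
      by (rule ennreal_tendsto_cmult[rotated]) (use fin in \<open>simp add: sqnorm_weighted_comp ennreal_mult_less_top\<close>)
    then show "(\<lambda>n. sqnorm (\<lambda>x. complex_of_real (k n s - l s) * weighted_comp s F x)) \<longlonglongrightarrow> 0"
      by (subst sqnorm_cmult) (auto simp: mult.commute simp del: of_real_diff)
  qed
  ultimately show ?thesis by simp
qed

lemma inj_on_phi_time:
  assumes "0 < x" "x < 1"
  shows "inj_on (\<lambda>s. phi s x) A"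
proof (rule inj_onI)
  fix s t assume "phi s x = phi t x"
  then have "exp (-s) * ((exp (-t) - 1) * x + 1) = exp (-t) * ((exp (-s) - 1) * x + 1)"
    using phi_denominator_pos[OF assms, of s] phi_denominator_pos[OF assms, of t] assms
    by (simp add: phi_def divide_simps)
  then have "exp (-s) * (1 - x) = exp (-t) * (1 - x)"
    by (simp add: algebra_simps)
  then show "s = t" using assms by simp
qed

text \<open>
  The trajectory of \<open>x\<close> runs monotonically from \<open>x\<close> down to \<open>0\<close>, so that it can serve as the
  variable of integration on \<open>(0, x)\<close>.
\<close>

lemma phi_time_image:
  assumes "0 < x" "x < 1"
  shows "(\<lambda>s. phi s x) ` {0<..} = {0<..<x}"
proof (intro equalityI subsetI)
  fix y assume "y \<in> (\<lambda>s. phi s x) ` {0<..}"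
  then obtain s where s: "0 < s" "y = phi s x" by auto
  have "phi s x \<noteq> phi 0 x"
    using inj_onD[OF inj_on_phi_time[OF assms, of UNIV], of s 0] s(1) by auto
  then show "y \<in> {0<..<x}"
    using phi_pos[OF assms] phi_le[OF assms, of s] s by auto
next
  fix y assume y: "y \<in> {0<..<x}"
  define a where "a = y * (1 - x) / (x * (1 - y))"
  have a: "0 < a" "a < 1"
    using y assms by (auto simp: a_def field_simps)
  have e: "exp (- (- ln a)) = a" using a by simp
  have ax: "a * x = y * (1 - x) / (1 - y)"
    using y assms by (simp add: a_def)
  have "(a - 1) * x + 1 = (1 - x) / (1 - y)"
    unfolding left_diff_distrib ax using y assms by (simp add: field_simps)
  then have "phi (- ln a) x = (y * (1 - x) / (1 - y)) / ((1 - x) / (1 - y))"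
    by (simp only: phi_def e ax)
  also have "\<dots> = y" using y assms by simp
  finally show "y \<in> (\<lambda>s. phi s x) ` {0<..}"
    using a by (intro image_eqI[of _ _ "- ln a"]) auto
qed

lemma set_integrable_cesaro_integrand:
  assumes F [measurable]: "F \<in> borel_measurable borel" and fin: "sqnorm F < \<infinity>" and x: "0 < x" "x < 1"
  shows "set_integrable lborel {0<..<x} (\<lambda>t. F t / complex_of_real (1 - t))"
  unfolding set_integrable_def
proof (rule integrableI_bounded)
  have "ennreal (norm (indicator {0<..<x} t *\<^sub>R (F t / complex_of_real (1 - t))))
    \<le> ennreal (1 / (1 - x)) * (indicator {0<..<1} t + ennreal ((cmod (F t))\<^sup>2) * indicator {0<..<1} t)" for t
  proof (cases "t \<in> {0<..<x}")
    case True
    have "cmod (F t) \<le> 1 + (cmod (F t))\<^sup>2"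
      using sum_squares_bound[of 1 "cmod (F t)"] norm_ge_zero[of "F t"]
      unfolding power_one by linarith
    then have "cmod (F t) / (1 - t) \<le> (1 + (cmod (F t))\<^sup>2) / (1 - x)"
      using True x by (intro frac_le) auto
    moreover have "norm (F t / complex_of_real (1 - t)) = cmod (F t) / (1 - t)"
      using True x by (simp only: norm_divide norm_of_real) simp
    ultimately have "ennreal (norm (F t / complex_of_real (1 - t))) \<le> ennreal (1 / (1 - x) * (1 + (cmod (F t))\<^sup>2))"
      by (intro ennreal_leI) simp
    also have "\<dots> = ennreal (1 / (1 - x)) * (1 + ennreal ((cmod (F t))\<^sup>2))"
      using x by (subst ennreal_mult) (auto simp: ennreal_plus)
    finally show ?thesis using True x by simp
  qed simp
  then have "(\<integral>\<^sup>+t. ennreal (norm (indicator {0<..<x} t *\<^sub>R (F t / complex_of_real (1 - t)))) \<partial>lborel)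
    \<le> (\<integral>\<^sup>+t. ennreal (1 / (1 - x)) * (indicator {0<..<1} t + ennreal ((cmod (F t))\<^sup>2) * indicator {0<..<1} t) \<partial>lborel)"
    by (intro nn_integral_mono)
  also have "\<dots> = ennreal (1 / (1 - x)) * (1 + sqnorm F)"
    by (subst nn_integral_cmult) (auto simp: nn_integral_add sqnorm_def)
  also have "\<dots> < \<infinity>"
    using fin by (simp add: ennreal_mult_less_top)
  finally show "(\<integral>\<^sup>+t. ennreal (norm (indicator {0<..<x} t *\<^sub>R (F t / complex_of_real (1 - t)))) \<partial>lborel) < \<infinity>" .
qed measurable

text \<open>
  Substitute \<open>t = \<phi>\<^sub>s(x)\<close> in the integral defining \<open>C F x\<close>: the derivative of \<open>\<phi>\<^sub>s(x)\<close> in \<open>s\<close> is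
  \<open>- t (1 - t)\<close>, which cancels the denominator \<open>1 - t\<close> and leaves the weight \<open>t = \<phi>\<^sub>s(x)\<close>.
\<close>

lemma cesaro_eq_time_average:
  assumes F [measurable]: "F \<in> borel_measurable borel" and fin: "sqnorm F < \<infinity>" and x: "0 < x" "x < 1"
  shows "cesaro F x = time_average (\<lambda>_. 1) F x"
proof -
  let ?f = "\<lambda>t. F t / complex_of_real (1 - t)"
  let ?h = "\<lambda>s. - (phi s x * (1 - phi s x))"
  have int: "?f absolutely_integrable_on (\<lambda>s. phi s x) ` {0<..}"
    using set_integrable_cesaro_integrand[OF F fin x]
    unfolding phi_time_image[OF x] set_integrable_def by (rule integrable_completion[THEN iffD2, rotated]) measurable
  have eq: "\<bar>?h s\<bar> *\<^sub>R ?f (phi s x) = complex_of_real x * weighted_comp s F x" for s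
  proof -
    have p: "0 < phi s x" "phi s x < 1" using phi_pos[OF x] phi_less_1[OF x] by auto
    then have "\<bar>?h s\<bar> = phi s x * (1 - phi s x)" by (simp add: abs_mult)
    moreover have "complex_of_real (1 - phi s x) \<noteq> 0"
      using p by (simp del: of_real_diff)
    ultimately show ?thesis
      using x by (simp add: weighted_comp_def scaleR_conv_of_real del: of_real_diff)
  qed
  have cov: "(\<lambda>s. \<bar>?h s\<bar> *\<^sub>R ?f (phi s x)) absolutely_integrable_on {0<..} \<and>
     integral {0<..} (\<lambda>s. \<bar>?h s\<bar> *\<^sub>R ?f (phi s x)) = integral ((\<lambda>s. phi s x) ` {0<..}) ?f"
    by (rule has_absolute_integral_change_of_variables_real[THEN iffD2])
      (use int in \<open>auto intro!: phi_has_derivative_time x inj_on_phi_time\<close>)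
  have "(LINT t:{0<..<x}|lebesgue. ?f t) = integral {0<..<x} ?f"
    using int unfolding phi_time_image[OF x] by (rule set_lebesgue_integral_eq_integral)
  also have "\<dots> = integral {0<..} (\<lambda>s. complex_of_real x * weighted_comp s F x)"
    using cov unfolding eq phi_time_image[OF x] by simp
  also have "\<dots> = (LINT s:{0<..}|lebesgue. complex_of_real x * weighted_comp s F x)"
    using cov unfolding eq by (intro set_lebesgue_integral_eq_integral(2)[symmetric]) simp
  also have "\<dots> = (LINT s:{0<..}|lborel. complex_of_real x * weighted_comp s F x)"
    unfolding set_lebesgue_integral_def by (rule integral_completion) measurable
  also have "\<dots> = (LINT s:{0..}|lborel. complex_of_real x * weighted_comp s F x)"
    unfolding set_lebesgue_integral_def
    by (rule integral_cong_AE) (use AE_lborel_singleton[of "0::real"] in \<open>auto elim!: eventually_mono simp: indicator_def\<close>)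
  also have "\<dots> = complex_of_real x * time_average (\<lambda>_. 1) F x"
    by (simp add: time_average_def)
  finally show ?thesis
    using x by (simp add: cesaro_def)
qed

lemma nn_integral_shifted_power:
  assumes "0 \<le> u"
  shows "(\<integral>\<^sup>+r\<in>{0..u}. ennreal ((u - r) ^ n) \<partial>lborel) = ennreal (u ^ Suc n / Suc n)"
proof -
  have deriv: "((\<lambda>r. - ((u - r) ^ Suc n / Suc n)) has_real_derivative (u - r) ^ n) (at r)" for r
    by (rule derivative_eq_intros refl | simp del: of_nat_Suc)+
  have "(\<integral>\<^sup>+r. ennreal ((u - r) ^ n) * indicator {0..u} r \<partial>lborel)
    = ennreal (- ((u - u) ^ Suc n / Suc n) - - ((u - 0) ^ Suc n / Suc n))"
    using assms
    by (intro nn_integral_FTC_Icc[where F="\<lambda>r. - ((u - r) ^ Suc n / Suc n)"])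
      (auto intro!: deriv simp del: power_Suc of_nat_Suc)
  then show ?thesis by simp
qed

text \<open>
  By the semigroup law the left side is the double integral of \<open>s\<^sup>n * S\<^sub>r\<^sub>+\<^sub>s F x\<close> over \<open>r, s \<ge> 0\<close>.
  With \<open>u = r + s\<close> the inner integral of \<open>(u - r)\<^sup>n\<close> over \<open>0 \<le> r \<le> u\<close> is \<open>u\<^sup>n\<^sup>+\<^sup>1 / (n + 1)\<close>. The
  integrability hypothesis holds for almost every \<open>x\<close>.
\<close>

lemma time_average_time_average_power:
  assumes F [measurable]: "F \<in> borel_measurable borel" and x: "0 < x" "x < 1"
    and int: "set_integrable lborel {0..} (\<lambda>u. complex_of_real (u ^ Suc n / Suc n) * weighted_comp u F x)"
  shows "time_average (\<lambda>_. 1) (time_average (\<lambda>s. s ^ n) F) x = time_average (\<lambda>u. u ^ Suc n / Suc n) F x"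
proof -
  \<comment> \<open>the double integral in the coordinates \<open>u = r + s\<close> and \<open>r\<close>\<close>
  let ?H = "\<lambda>u r. complex_of_real (indicator {0..u} r * (u - r) ^ n) * (indicator {0..} u *\<^sub>R weighted_comp u F x)"
  have meas [measurable]: "case_prod ?H \<in> borel_measurable (lborel \<Otimes>\<^sub>M lborel)"
    unfolding indicator_def of_bool_def atLeastAtMost_iff atLeast_iff by measurable
  have inner: "(\<integral>\<^sup>+r. ennreal (norm (?H u r)) \<partial>lborel)
     = ennreal (norm (indicator {0..} u *\<^sub>R (complex_of_real (u ^ Suc n / Suc n) * weighted_comp u F x)))" for u
  proof (cases "0 \<le> u")
    case True
    have "(\<integral>\<^sup>+r. ennreal (norm (?H u r)) \<partial>lborel)
      = (\<integral>\<^sup>+r. ennreal ((u - r) ^ n) * indicator {0..u} r * ennreal (cmod (weighted_comp u F x)) \<partial>lborel)"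
      using True by (intro nn_integral_cong) (auto simp: indicator_def norm_mult norm_power ennreal_mult' simp del: of_real_diff simp flip: of_real_diff)
    also have "\<dots> = ennreal (u ^ Suc n / Suc n) * ennreal (cmod (weighted_comp u F x))"
      by (subst nn_integral_multc) (simp_all only: nn_integral_shifted_power[OF True], measurable)
    also have "\<dots> = ennreal (norm (complex_of_real (u ^ Suc n / Suc n) * weighted_comp u F x))"
      using True by (subst ennreal_mult'[symmetric]) (simp_all only: norm_mult norm_of_real abs_of_nonneg divide_nonneg_nonneg zero_le_power of_nat_0_le_iff)
    finally show ?thesis using True by simp
  qed simp
  have meas_norm: "(\<lambda>w. ennreal (norm (case_prod ?H w))) \<in> borel_measurable (lborel \<Otimes>\<^sub>M lborel)"
    by (rule measurable_compose[OF measurable_compose[OF meas borel_measurable_norm] measurable_ennreal])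
  have pair: "integrable (lborel \<Otimes>\<^sub>M lborel) (case_prod ?H)"
  proof (rule integrableI_bounded)
    have "(\<integral>\<^sup>+w. ennreal (norm (case_prod ?H w)) \<partial>(lborel \<Otimes>\<^sub>M lborel)) = (\<integral>\<^sup>+u. \<integral>\<^sup>+r. ennreal (norm (?H u r)) \<partial>lborel \<partial>lborel)"
      by (simp only: lborel.nn_integral_fst[OF meas_norm, symmetric] prod.case)
    also have "\<dots> < \<infinity>"
      unfolding inner using int unfolding set_integrable_def integrable_iff_bounded by simp
    finally show "(\<integral>\<^sup>+w. ennreal (norm (case_prod ?H w)) \<partial>(lborel \<Otimes>\<^sub>M lborel)) < \<infinity>" .
  qed (rule meas)
  have "(\<integral>r. (\<integral>u. ?H u r \<partial>lborel) \<partial>lborel) = (\<integral>u. (\<integral>r. ?H u r \<partial>lborel) \<partial>lborel)"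
    by (rule lborel_pair.Fubini_integral[OF pair])
  also have "(\<lambda>u. \<integral>r. ?H u r \<partial>lborel) = (\<lambda>u. indicator {0..} u *\<^sub>R (complex_of_real (u ^ Suc n / Suc n) * weighted_comp u F x))"
  proof
    fix u :: real
    show "(\<integral>r. ?H u r \<partial>lborel) = indicator {0..} u *\<^sub>R (complex_of_real (u ^ Suc n / Suc n) * weighted_comp u F x)"
    proof (cases "0 \<le> u")
      case True
      have "(\<integral>r. indicator {0..u} r * (u - r) ^ n \<partial>lborel) = enn2real (\<integral>\<^sup>+r. ennreal (indicator {0..u} r * (u - r) ^ n) \<partial>lborel)"
        by (rule integral_eq_nn_integral) (auto simp: indicator_def)
      also have "(\<integral>\<^sup>+r. ennreal (indicator {0..u} r * (u - r) ^ n) \<partial>lborel) = (\<integral>\<^sup>+r\<in>{0..u}. ennreal ((u - r) ^ n) \<partial>lborel)"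
        by (intro nn_integral_cong) (auto simp: indicator_def)
      also have "enn2real \<dots> = u ^ Suc n / Suc n"
        using True by (simp only: nn_integral_shifted_power[OF True]) simp
      finally have I: "(\<integral>r. indicator {0..u} r * (u - r) ^ n \<partial>lborel) = u ^ Suc n / Suc n" .
      have "(\<integral>r. ?H u r \<partial>lborel) = (\<integral>r. complex_of_real (indicator {0..u} r * (u - r) ^ n) \<partial>lborel) * (indicator {0..} u *\<^sub>R weighted_comp u F x)"
        by (rule integral_mult_left_zero)
      also have "\<dots> = complex_of_real (u ^ Suc n / Suc n) * (indicator {0..} u *\<^sub>R weighted_comp u F x)"
        by (simp only: integral_complex_of_real I)
      finally show ?thesis using True by simp
    qed simp
  qed
  also have "(\<integral>u. indicator {0..} u *\<^sub>R (complex_of_real (u ^ Suc n / Suc n) * weighted_comp u F x) \<partial>lborel)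
     = time_average (\<lambda>u. u ^ Suc n / Suc n) F x"
    by (simp only: time_average_def set_lebesgue_integral_def)
  also have "(\<lambda>r. \<integral>u. ?H u r \<partial>lborel) = (\<lambda>r. indicator {0..} r *\<^sub>R weighted_comp r (time_average (\<lambda>s. s ^ n) F) x)"
  proof
    fix r :: real
    show "(\<integral>u. ?H u r \<partial>lborel) = indicator {0..} r *\<^sub>R weighted_comp r (time_average (\<lambda>s. s ^ n) F) x"
    proof (cases "0 \<le> r")
      case True
      have "(\<integral>u. ?H u r \<partial>lborel) = (\<integral>s. ?H (r + s) r \<partial>lborel)"
        using lborel_integral_real_affine[of 1 "\<lambda>u. ?H u r" r] by simp
      also have "\<dots> = (\<integral>s. complex_of_real (phi r x / x) * (indicator {0..} s *\<^sub>R (complex_of_real (s ^ n) * weighted_comp s F (phi r x))) \<partial>lborel)"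
      proof (rule Bochner_Integration.integral_cong[OF refl])
        fix s :: real
        have "weighted_comp (r + s) F x = complex_of_real (phi r x / x) * weighted_comp s F (phi r x)"
          using weighted_comp_weighted_comp[OF x, of r s F] by (simp add: weighted_comp_def[of r])
        then show "?H (r + s) r = complex_of_real (phi r x / x) * (indicator {0..} s *\<^sub>R (complex_of_real (s ^ n) * weighted_comp s F (phi r x)))"
          using True by (auto simp: indicator_def)
      qed
      also have "\<dots> = complex_of_real (phi r x / x) * time_average (\<lambda>s. s ^ n) F (phi r x)"
        by (simp only: time_average_def set_lebesgue_integral_def integral_mult_right_zero)
      finally show ?thesis
        using True by (simp add: weighted_comp_def[of r])
    next
      case False
      then have "?H u r = 0" for u by (auto simp: indicator_def)
      then show ?thesis using False by simp
    qed
  qed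
  also have "(\<integral>r. indicator {0..} r *\<^sub>R weighted_comp r (time_average (\<lambda>s. s ^ n) F) x \<partial>lborel)
     = time_average (\<lambda>_. 1) (time_average (\<lambda>s. s ^ n) F) x"
    by (simp add: time_average_def[of "\<lambda>_. 1"] set_lebesgue_integral_def)
  finally show ?thesis .
qed

section \<open>Closed subspaces and Borel representatives\<close>

lemma AE_unit_measureI:
  assumes "AE x in lborel. x \<in> {0<..<1} \<longrightarrow> P x"
  shows "AE x in unit_measure. P x"
  using AE_completion[OF assms] by (subst AE_restrict_space_iff) auto

lemma borel_imp_unit_measurable: "F \<in> borel_measurable borel \<Longrightarrow> F \<in> borel_measurable unit_measure"
  by (intro measurable_restrict_space1 measurable_completion) simp

lemma nn_integral_unit_measure: 
  "(\<integral>\<^sup>+x. ennreal ((cmod (F x))\<^sup>2) \<partial>unit_measure) = sqnorm F"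
  by (simp add: nn_integral_restrict_space nn_integral_completion sqnorm_def)

lemma L2_norm_eq_sqnorm:
  assumes "F \<in> borel_measurable borel"
  shows "L2_norm F = sqrt (enn2real (sqnorm F))"
proof -
  have [measurable]: "F \<in> borel_measurable unit_measure"
    by (rule borel_imp_unit_measurable) fact
  show ?thesis
    unfolding L2_norm_def by (subst integral_eq_nn_integral) (simp_all add: nn_integral_unit_measure)
qed

lemma borel_in_L2_iff:
  assumes "F \<in> borel_measurable borel"
  shows "F \<in> L2 \<longleftrightarrow> sqnorm F < \<infinity>"
proof -
  have [measurable]: "F \<in> borel_measurable unit_measure"
    by (rule borel_imp_unit_measurable) fact
  show ?thesis
    by (simp add: L2_def integrable_iff_bounded nn_integral_unit_measure)
qed

lemma unit_measurable_AE_cong: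
  fixes f F :: "real \<Rightarrow> complex"
  assumes F [measurable]: "F \<in> borel_measurable borel" and eq: "AE x in lborel. x \<in> {0<..<1} \<longrightarrow> f x = F x"
  shows "f \<in> borel_measurable unit_measure"
proof -
  have "(\<lambda>x. if x \<in> {0<..<1} then F x else 0) \<in> borel_measurable lebesgue"
    by (rule measurable_completion) measurable
  moreover have "AE x in lebesgue. (if x \<in> {0<..<1} then F x else 0) = (if x \<in> {0<..<1} then f x else 0)"
    by (rule AE_completion) (use eq in \<open>auto elim!: eventually_mono\<close>)
  ultimately have "(\<lambda>x. if x \<in> {0<..<1} then f x else 0) \<in> borel_measurable lebesgue"
    by (rule borel_measurable_AE)
  then show ?thesis
    by (rule borel_measurable_if_D)
qed

lemma L2_borel_representative:
  assumes "f \<in> L2"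
  obtains F where "F \<in> borel_measurable borel" "AE x in lborel. x \<in> {0<..<1} \<longrightarrow> f x = F x"
proof -
  let ?f = "\<lambda>x. if x \<in> {0<..<1} then f x else 0"
  have "?f \<in> borel_measurable lebesgue"
    using assms unfolding L2_def by (intro borel_measurable_if_I) simp_all
  then have "(\<lambda>x. Re (?f x)) \<in> borel_measurable lebesgue" "(\<lambda>x. Im (?f x)) \<in> borel_measurable lebesgue"
    by measurable
  from this[THEN completion_ex_borel_measurable_real]
  obtain a b where "a \<in> borel_measurable lborel" "b \<in> borel_measurable lborel"
    and ab: "AE x in lborel. Re (?f x) = a x" "AE x in lborel. Im (?f x) = b x"
    by blast
  then have [measurable]: "a \<in> borel_measurable borel" "b \<in> borel_measurable borel"
    by simp_all
  show thesis
  proof (rule that)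
    show "(\<lambda>x. complex_of_real (a x) + \<i> * complex_of_real (b x)) \<in> borel_measurable borel"
      by measurable
    show "AE x in lborel. x \<in> {0<..<1} \<longrightarrow> f x = complex_of_real (a x) + \<i> * complex_of_real (b x)"
      using ab by eventually_elim (auto simp: complex_eq_iff)
  qed
qed

lemma closed_subspace_cong_AE:
  assumes "L2_closed_subspace M" "f \<in> M" "F \<in> borel_measurable borel"
    and "AE x in lborel. x \<in> {0<..<1} \<longrightarrow> f x = F x"
  shows "F \<in> M"
  using assms(1,2) borel_imp_unit_measurable[OF assms(3)] AE_unit_measureI[OF assms(4)]
  by (rule L2_closed_subspace_AE)

text \<open>
  The transfer from a Borel representative back to an arbitrary one; the measurability of \<open>f\<close>
  comes from the completeness of Lebesgue measure.
\<close>

lemma closed_subspace_representative_cong: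
  assumes "L2_closed_subspace M" "F \<in> M" "F \<in> borel_measurable borel"
    and eq: "AE x in lborel. x \<in> {0<..<1} \<longrightarrow> f x = F x"
  shows "f \<in> M"
  using assms(1,2) unit_measurable_AE_cong[OF assms(3,4)]
  by (rule L2_closed_subspace_AE) (rule AE_unit_measureI, use eq in \<open>auto elim!: eventually_mono\<close>)

lemma closed_subspace_sqnorm_finite:
  assumes "L2_closed_subspace M" "F \<in> M" "F \<in> borel_measurable borel"
  shows "sqnorm F < \<infinity>"
proof -
  have "F \<in> L2" using assms(1,2) by (auto simp: L2_closed_subspace_def L2_subspace_def)
  then show ?thesis using borel_in_L2_iff[OF assms(3)] by simp
qed

lemma closed_subspace_add: "L2_closed_subspace M \<Longrightarrow> f \<in> M \<Longrightarrow> g \<in> M \<Longrightarrow> (\<lambda>x. f x + g x) \<in> M"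
  by (simp add: L2_closed_subspace_def L2_subspace_def)

lemma closed_subspace_cmult: "L2_closed_subspace M \<Longrightarrow> f \<in> M \<Longrightarrow> (\<lambda>x. c * f x) \<in> M"
  by (simp add: L2_closed_subspace_def L2_subspace_def)

lemma closed_subspace_sum:
  assumes "L2_closed_subspace M" "finite A" "\<And>a. a \<in> A \<Longrightarrow> f a \<in> M"
  shows "(\<lambda>x. \<Sum>a\<in>A. f a x) \<in> M"
  using assms(2,3)
proof induction
  case empty
  then show ?case using assms(1) by (simp add: L2_closed_subspace_def L2_subspace_def)
next
  case (insert a A)
  then show ?case using closed_subspace_add[OF assms(1), of "f a"] by simp
qed

lemma closed_subspace_limit:
  assumes M: "L2_closed_subspace M"
    and F: "\<And>n. F n \<in> M" "\<And>n. F n \<in> borel_measurable borel"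
    and G: "G \<in> borel_measurable borel" "sqnorm G < \<infinity>"
    and lim: "(\<lambda>n. sqnorm (\<lambda>x. F n x - G x)) \<longlonglongrightarrow> 0"
  shows "G \<in> M"
proof -
  have "(\<lambda>n. sqrt (enn2real (sqnorm (\<lambda>x. F n x - G x)))) \<longlonglongrightarrow> sqrt 0"
    by (intro tendsto_real_sqrt tendsto_enn2real) (use lim in simp_all)
  moreover have "L2_norm (\<lambda>x. F n x - G x) = sqrt (enn2real (sqnorm (\<lambda>x. F n x - G x)))" for n
    using F(2) G(1) by (intro L2_norm_eq_sqnorm) simp
  ultimately have "(\<lambda>n. L2_norm (\<lambda>x. F n x - G x)) \<longlonglongrightarrow> 0"
    by simp
  moreover have "G \<in> L2" using borel_in_L2_iff[OF G(1)] G(2) by simp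
  moreover have "L2_closed M" using M by (simp add: L2_closed_subspace_def)
  ultimately show ?thesis using F(1) unfolding L2_closed_def by blast
qed

lemma weighted_comp_cong_AE:
  assumes eq: "AE x in lborel. x \<in> {0<..<1} \<longrightarrow> f x = F x"
  shows "AE x in lborel. x \<in> {0<..<1} \<longrightarrow> weighted_comp t f x = weighted_comp t F x"
proof -
  obtain N where N': "\<And>x. x \<in> space lborel - N \<Longrightarrow> x \<in> {0<..<1} \<longrightarrow> f x = F x" and N: "N \<in> null_sets lborel"
    by (rule AE_E3[OF eq]) blast
  then have [measurable]: "N \<in> sets borel" by auto
  have "(\<integral>\<^sup>+x\<in>{0<..<1}. ennreal ((phi t x / x)\<^sup>2) * indicator N (phi t x) \<partial>lborel)
    = ennreal (exp (-t)) * (\<integral>\<^sup>+x\<in>{0<..<1}. indicator N x \<partial>lborel)"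
    by (rule nn_integral_weighted_phi) measurable
  also have "(\<integral>\<^sup>+x\<in>{0<..<1}. indicator N x \<partial>lborel) = (\<integral>\<^sup>+(x::real). 0 \<partial>lborel)"
    by (rule nn_integral_cong_AE) (use AE_not_in[OF N] in \<open>auto elim!: eventually_mono\<close>)
  finally have "(\<integral>\<^sup>+x\<in>{0<..<1}. ennreal ((phi t x / x)\<^sup>2) * indicator N (phi t x) \<partial>lborel) = 0"
    by simp
  then have "AE x in lborel. ennreal ((phi t x / x)\<^sup>2) * indicator N (phi t x) * indicator {0<..<1} x = 0"
    by (subst (asm) nn_integral_0_iff_AE) measurable
  then show ?thesis
  proof eventually_elim
    fix x :: real assume *: "ennreal ((phi t x / x)\<^sup>2) * indicator N (phi t x) * indicator {0<..<1} x = 0"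
    show "x \<in> {0<..<1} \<longrightarrow> weighted_comp t f x = weighted_comp t F x"
    proof
      assume x: "x \<in> {0<..<1}"
      then have p: "0 < phi t x" "phi t x < 1" using phi_pos phi_less_1 by auto
      then have "0 < (phi t x / x)\<^sup>2" using x by simp
      with * x have "phi t x \<notin> N" by (auto simp: indicator_def split: if_splits)
      then show "weighted_comp t f x = weighted_comp t F x"
        using N'[of "phi t x"] p by (simp add: weighted_comp_def)
    qed
  qed
qed

lemma cesaro_cong_AE:
  assumes eq: "AE x in lborel. x \<in> {0<..<1} \<longrightarrow> f x = F x" 
    and F [measurable]: "F \<in> borel_measurable borel" and x: "0 < x" "x < 1"
  shows "cesaro f x = cesaro F x"
proof -
  let ?g = "\<lambda>h t. indicator {0<..<x} t *\<^sub>R (h t / complex_of_real (1 - t))"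
  have ae: "AE t in lebesgue. ?g F t = ?g f t"
    by (rule AE_completion) (use eq x in \<open>auto elim!: eventually_mono simp: indicator_def\<close>)
  have meas: "?g F \<in> borel_measurable lebesgue" by (rule measurable_completion) measurable
  have "integral\<^sup>L lebesgue (?g f) = integral\<^sup>L lebesgue (?g F)"
    by (rule integral_cong_AE[OF borel_measurable_AE[OF meas ae] meas]) (use ae in \<open>auto elim!: eventually_mono\<close>)
  then show ?thesis by (simp add: cesaro_def set_lebesgue_integral_def)
qed

section \<open>Kernels whose averages leave a subspace invariant\<close>

text \<open>
  Only Borel functions are tested, because the joint measurability of \<open>(s, x) \<mapsto> S\<^sub>s F x\<close> is not
  clear for other representatives.
\<close>

definition invariant_kernel :: "(real \<Rightarrow> complex) set \<Rightarrow> (real \<Rightarrow> real) \<Rightarrow> bool"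
  where "invariant_kernel M k \<longleftrightarrow> (\<exists>B. admissible_kernel k B) \<and>
    (\<forall>F\<in>M. F \<in> borel_measurable borel \<longrightarrow> time_average k F \<in> M)"

lemma invariant_kernel_add:
  assumes M: "L2_closed_subspace M" and k: "invariant_kernel M k" and l: "invariant_kernel M l"
  shows "invariant_kernel M (\<lambda>s. k s + l s)"
proof -
  obtain B C where B: "admissible_kernel k B" and C: "admissible_kernel l C"
    using k l by (auto simp: invariant_kernel_def)
  have [measurable]: "k \<in> borel_measurable borel" "l \<in> borel_measurable borel"
    using B C by (auto simp: admissible_kernel_def)
  have "admissible_kernel (\<lambda>s. - l s) C" using C by (simp add: admissible_kernel_def)
  from admissible_kernel_diff[OF B this]
  have "admissible_kernel (\<lambda>s. k s + l s) (B + C)" by simp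
  moreover have "time_average (\<lambda>s. k s + l s) F \<in> M" if F: "F \<in> M" "F \<in> borel_measurable borel" for F
  proof (rule closed_subspace_cong_AE[OF M])
    show "(\<lambda>x. time_average k F x + time_average l F x) \<in> M"
      using k l F by (intro closed_subspace_add[OF M]) (auto simp: invariant_kernel_def)
    show "time_average (\<lambda>s. k s + l s) F \<in> borel_measurable borel"
      using F(2) by measurable
    show "AE x in lborel. x \<in> {0<..<1} \<longrightarrow>
        time_average k F x + time_average l F x = time_average (\<lambda>s. k s + l s) F x"
      using time_average_add[OF B C F(2) closed_subspace_sqnorm_finite[OF M F]]
      by (auto elim!: eventually_mono)
  qed
  ultimately show ?thesis unfolding invariant_kernel_def by blast
qed

lemma invariant_kernel_cmult:
  assumes M: "L2_closed_subspace M" and k: "invariant_kernel M k"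
  shows "invariant_kernel M (\<lambda>s. c * k s)"
proof -
  obtain B where B: "admissible_kernel k B"
    using k by (auto simp: invariant_kernel_def)
  have "admissible_kernel (\<lambda>s. c * k s) (\<bar>c\<bar> * B)"
    using B by (auto simp: admissible_kernel_def abs_mult mult.assoc intro: mult_left_mono)
  moreover have "time_average (\<lambda>s. c * k s) F = (\<lambda>x. complex_of_real c * time_average k F x)" for F
    by (rule ext) (simp only: time_average_cmult)
  ultimately show ?thesis
    using k closed_subspace_cmult[OF M] unfolding invariant_kernel_def by auto
qed

lemma invariant_kernel_diff:
  assumes M: "L2_closed_subspace M" and k: "invariant_kernel M k" and l: "invariant_kernel M l"
  shows "invariant_kernel M (\<lambda>s. k s - l s)"
  using invariant_kernel_add[OF M k invariant_kernel_cmult[OF M l, of "-1"]] by simp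

lemma invariant_kernel_sum:
  assumes M: "L2_closed_subspace M" and "finite A" and "\<And>a. a \<in> A \<Longrightarrow> invariant_kernel M (k a)"
  shows "invariant_kernel M (\<lambda>s. \<Sum>a\<in>A. k a s)"
  using assms(2,3)
proof induction
  case empty
  have "time_average (\<lambda>s. 0) F = (\<lambda>x. 0)" for F
    by (simp add: time_average_def fun_eq_iff)
  moreover have "admissible_kernel (\<lambda>s. 0) 0"
    by (simp add: admissible_kernel_def)
  ultimately show ?case
    using M by (auto simp: invariant_kernel_def L2_closed_subspace_def L2_subspace_def)
next
  case (insert a A)
  then show ?case using invariant_kernel_add[OF M, of "k a"] by simp
qed

lemma invariant_kernel_limit:
  assumes M: "L2_closed_subspace M" and k: "\<And>n. invariant_kernel M (k n)"
    and bound: "\<And>n s. 0 \<le> s \<Longrightarrow> \<bar>k n s\<bar> \<le> B * exp (3 * s / 8)"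
    and l: "l \<in> borel_measurable borel" and lim: "\<And>s. 0 \<le> s \<Longrightarrow> (\<lambda>n. k n s) \<longlonglongrightarrow> l s"
  shows "invariant_kernel M l"
proof -
  have kB: "admissible_kernel (k n) B" for n
    using k[of n] bound by (auto simp: invariant_kernel_def admissible_kernel_def)
  have "\<bar>l s\<bar> \<le> B * exp (3 * s / 8)" if "0 \<le> s" for s
    using tendsto_rabs[OF lim[OF that]] bound[OF that] by (intro LIMSEQ_le_const2) auto
  then have lB: "admissible_kernel l B"
    using l by (simp add: admissible_kernel_def)
  have "time_average l F \<in> M" if F: "F \<in> M" "F \<in> borel_measurable borel" for F
  proof (rule closed_subspace_limit[OF M])
    have fin: "sqnorm F < \<infinity>" by (rule closed_subspace_sqnorm_finite[OF M F])
    show "time_average (k n) F \<in> M" for n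
      using k[of n] F by (simp add: invariant_kernel_def)
    show "time_average (k n) F \<in> borel_measurable borel" for n
      using kB[of n] F(2) by (intro measurable_time_average) (auto simp: admissible_kernel_def)
    show "time_average l F \<in> borel_measurable borel"
      using l F(2) by (rule measurable_time_average)
    show "sqnorm (time_average l F) < \<infinity>"
      by (rule sqnorm_time_average_finite[OF lB F(2) fin])
    show "(\<lambda>n. sqnorm (\<lambda>x. time_average (k n) F x - time_average l F x)) \<longlonglongrightarrow> 0"
      by (rule time_average_tendsto[OF kB lB lim F(2) fin])
  qed
  with lB show ?thesis by (auto simp: invariant_kernel_def)
qed

lemma power_le_exp:
  fixes c :: real
  assumes "0 < c"
  shows "\<exists>B\<ge>(0::real). \<forall>s\<ge>0. s ^ n \<le> B * exp (c * s)"
proof (intro exI[of _ "fact n / c ^ n"] conjI allI impI)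
  show "0 \<le> fact n / c ^ n" using assms by simp
  fix s :: real assume "0 \<le> s"
  then have "(\<Sum>i\<in>{n}. inverse (fact i) * (c * s) ^ i) \<le> (\<Sum>i. inverse (fact i) * (c * s) ^ i)"
    using assms by (intro sum_le_suminf) (auto intro: summable_exp simp: summable_exp)
  also have "\<dots> = exp (c * s)"
    by (simp add: exp_def field_simps)
  finally show "s ^ n \<le> fact n / c ^ n * exp (c * s)"
    using assms by (simp add: field_simps power_mult_distrib)
qed

text \<open>
  Iterating \<open>C\<close>: up to factorials, its powers are the averages against powers of \<open>s\<close>.
\<close>

lemma invariant_kernel_power:
  assumes M: "L2_closed_subspace M" and one: "invariant_kernel M (\<lambda>_. 1)"
  shows "invariant_kernel M (\<lambda>s. s ^ n)"
proof (induction n)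
  case 0
  show ?case using one by simp
next
  case (Suc n)
  let ?l = "\<lambda>s::real. s ^ Suc n / real (Suc n)"
  have "\<exists>B\<ge>(0::real). \<forall>s\<ge>0. s ^ Suc n \<le> B * exp (3 / 8 * s)"
    by (rule power_le_exp) simp
  then obtain B :: real where B: "0 \<le> B" "\<And>s. 0 \<le> s \<Longrightarrow> s ^ Suc n \<le> B * exp (3 / 8 * s)"
    by blast
  have "\<bar>?l s\<bar> \<le> B * exp (3 * s / 8)" if "0 \<le> s" for s
  proof -
    have "\<bar>?l s\<bar> \<le> s ^ Suc n / 1"
      using that by (simp only: abs_of_nonneg zero_le_power divide_nonneg_nonneg of_nat_0_le_iff) (rule frac_le, auto)
    then show ?thesis using B(2)[OF that] by simp
  qed
  then have lB: "admissible_kernel ?l B"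
    by (simp add: admissible_kernel_def)
  have "time_average ?l F \<in> M" if F: "F \<in> M" "F \<in> borel_measurable borel" for F
  proof (rule closed_subspace_cong_AE[OF M])
    have meas: "time_average (\<lambda>s. s ^ n) F \<in> borel_measurable borel"
      using F(2) by measurable
    show "time_average (\<lambda>_. 1) (time_average (\<lambda>s. s ^ n) F) \<in> M"
      using one Suc F meas by (simp add: invariant_kernel_def)
    show "time_average ?l F \<in> borel_measurable borel"
      using F(2) by measurable
    show "AE x in lborel. x \<in> {0<..<1} \<longrightarrow>
        time_average (\<lambda>_. 1) (time_average (\<lambda>s. s ^ n) F) x = time_average ?l F x"
      using AE_kernel_integrable[OF lB F(2) closed_subspace_sqnorm_finite[OF M F]]
      by eventually_elim (use time_average_time_average_power[OF F(2)] in auto)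
  qed
  with lB have "invariant_kernel M ?l" by (auto simp: invariant_kernel_def)
  from invariant_kernel_cmult[OF M this, of "real (Suc n)"]
  show ?case by (simp del: of_nat_Suc power_Suc)
qed

text \<open>
  The Taylor polynomials of \<open>exp (- c * s)\<close> are bounded by \<open>exp (c * s)\<close>, which is admissible only for
  small \<open>c\<close>. So the exponent is lowered in steps of \<open>1 / 4\<close>, each time multiplying the kernels already
  obtained by the Taylor polynomials of \<open>exp (- s / 4)\<close>.
\<close>

lemma invariant_kernel_power_exp:
  assumes M: "L2_closed_subspace M" and one: "invariant_kernel M (\<lambda>_. 1)"
  shows "invariant_kernel M (\<lambda>s. s ^ n * exp (- (s / 4)) ^ j)"
proof (induction j arbitrary: n)
  case 0
  show ?case using invariant_kernel_power[OF M one] by simp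
next
  case (Suc j)
  have "\<exists>B\<ge>(0::real). \<forall>s\<ge>0. s ^ n \<le> B * exp (1 / 8 * s)"
    by (rule power_le_exp) simp
  then obtain B :: real where B: "0 \<le> B" "\<And>s. 0 \<le> s \<Longrightarrow> s ^ n \<le> B * exp (1 / 8 * s)"
    by blast
  let ?term = "\<lambda>i (s::real). (- (s / 4)) ^ i /\<^sub>R fact i"
  let ?k = "\<lambda>m s. s ^ n * exp (- (s / 4)) ^ j * (\<Sum>i<m. ?term i s)"
  show ?case
  proof (rule invariant_kernel_limit[OF M])
    fix m
    have "invariant_kernel M (\<lambda>s. \<Sum>i<m. (- 1 / 4) ^ i / fact i * (s ^ (n + i) * exp (- (s / 4)) ^ j))"
      by (intro invariant_kernel_sum[OF M _ invariant_kernel_cmult[OF M Suc]]) simp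
    also have "(\<lambda>s. \<Sum>i<m. (- 1 / 4) ^ i / fact i * (s ^ (n + i) * exp (- (s / 4)) ^ j)) = ?k m"
    proof
      fix s :: real
      have "(- 1 / 4) ^ i / fact i * (s ^ (n + i) * exp (- (s / 4)) ^ j) = s ^ n * exp (- (s / 4)) ^ j * ?term i s" for i
      proof -
        have "(- (s / 4)) ^ i = (- 1 / 4) ^ i * s ^ i"
          by (simp add: power_mult_distrib[symmetric])
        then show ?thesis unfolding power_add real_scaleR_def by (simp only: divide_inverse mult_ac)
      qed
      then show "(\<Sum>i<m. (- 1 / 4) ^ i / fact i * (s ^ (n + i) * exp (- (s / 4)) ^ j)) = ?k m s"
        by (simp only: sum_distrib_left)
    qed
    finally show "invariant_kernel M (?k m)" .
    fix s :: real assume s: "0 \<le> s"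
    have "\<bar>\<Sum>i<m. ?term i s\<bar> \<le> (\<Sum>i<m. (s / 4) ^ i /\<^sub>R fact i)"
      by (rule order_trans[OF sum_abs]) (use s in \<open>simp add: power_abs abs_mult\<close>)
    also have "\<dots> \<le> (\<Sum>i. (s / 4) ^ i /\<^sub>R fact i)"
      using s by (intro sum_le_suminf summable_exp_generic) auto
    also have "\<dots> = exp (s / 4)" by (simp add: exp_def)
    finally have 1: "\<bar>\<Sum>i<m. ?term i s\<bar> \<le> exp (s / 4)" .
    have 2: "\<bar>s ^ n * exp (- (s / 4)) ^ j\<bar> \<le> B * exp (1 / 8 * s) * 1"
      unfolding abs_mult using s B by (intro mult_mono) (auto intro!: power_le_one)
    have "\<bar>?k m s\<bar> \<le> (B * exp (1 / 8 * s) * 1) * exp (s / 4)"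
      unfolding abs_mult[of "s ^ n * exp (- (s / 4)) ^ j"] using B(1) by (intro mult_mono 1 2) auto
    also have "\<dots> = B * (exp (1 / 8 * s) * exp (s / 4))" by simp
    also have "exp (1 / 8 * s) * exp (s / 4) = exp (3 * s / 8)"
      by (simp add: exp_add[symmetric])
    finally show "\<bar>?k m s\<bar> \<le> B * exp (3 * s / 8)" .
    have "(\<lambda>m. \<Sum>i<m. ?term i s) \<longlonglongrightarrow> exp (- (s / 4))"
      using exp_converges[of "- (s / 4)"] by (simp only: sums_def)
    then have "(\<lambda>m. ?k m s) \<longlonglongrightarrow> s ^ n * exp (- (s / 4)) ^ j * exp (- (s / 4))"
      by (rule tendsto_mult_left)
    then show "(\<lambda>m. ?k m s) \<longlonglongrightarrow> s ^ n * exp (- (s / 4)) ^ Suc j"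
      by (simp only: power_Suc2 mult.assoc)
  qed measurable
qed

lemma invariant_kernel_Bernstein:
  assumes M: "L2_closed_subspace M" and one: "invariant_kernel M (\<lambda>_. 1)"
  shows "invariant_kernel M (\<lambda>s. \<Sum>i\<le>n. c i * Bernstein n i (exp (- (s / 4))))"
proof -
  have prod: "invariant_kernel M (\<lambda>s. exp (- (s / 4)) ^ i * (1 - exp (- (s / 4))) ^ m)" for i m
  proof (induction m arbitrary: i)
    case 0
    show ?case using invariant_kernel_power_exp[OF M one, of 0 i] by simp
  next
    case (Suc m)
    show ?case
      using invariant_kernel_diff[OF M Suc[of i] Suc[of "Suc i"]] by (simp add: algebra_simps)
  qed
  have "invariant_kernel M (\<lambda>s. c i * Bernstein n i (exp (- (s / 4))))" for i
    using invariant_kernel_cmult[OF M prod[of i "n - i"], of "c i * real (n choose i)"]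
    by (simp only: Bernstein_def mult.assoc)
  then show ?thesis by (intro invariant_kernel_sum[OF M]) auto
qed

text \<open>
  In the variable \<open>u = exp (- s / 4)\<close> the half-line \<open>s > t\<close> is the interval \<open>u < exp (- t / 4)\<close>. Its
  indicator function is the limit of ramps of increasing slope, and each ramp is approximated
  uniformly by a Bernstein polynomial in \<open>u\<close>.
\<close>

lemma invariant_kernel_tail:
  assumes M: "L2_closed_subspace M" and one: "invariant_kernel M (\<lambda>_. 1)"
  shows "invariant_kernel M (indicator {t<..})"
proof -
  define u where "u = exp (- (t / 4))"
  define q where "q = (\<lambda>m x. min 1 (max 0 (real m * (u - x))))"
  have "\<exists>n. \<forall>x\<in>{0..1}. \<bar>q m x - (\<Sum>i\<le>n. q m (i / n) * Bernstein n i x)\<bar> < 1 / Suc m" for m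
  proof -
    have "continuous_on {0..1} (q m)" unfolding q_def by (intro continuous_intros)
    moreover have "0 < 1 / real (Suc m)" by simp
    ultimately show ?thesis using Bernstein_Weierstrass by (meson order_refl)
  qed
  then obtain N where N: "\<And>m x. x \<in> {0..1} \<Longrightarrow>
      \<bar>q m x - (\<Sum>i\<le>N m. q m (i / N m) * Bernstein (N m) i x)\<bar> < 1 / Suc m"
    by metis
  define k where "k = (\<lambda>m s. \<Sum>i\<le>N m. q m (i / N m) * Bernstein (N m) i (exp (- (s / 4))))"
  have approx: "\<bar>q m (exp (- (s / 4))) - k m s\<bar> < 1 / Suc m" if "0 \<le> s" for m s
    unfolding k_def by (rule N) (use that in auto)
  show ?thesis
  proof (rule invariant_kernel_limit[OF M])
    show "invariant_kernel M (k m)" for m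
      unfolding k_def by (rule invariant_kernel_Bernstein[OF M one])
    fix s :: real assume s: "0 \<le> s"
    have lim: "(\<lambda>m. q m (exp (- (s / 4)))) \<longlonglongrightarrow> indicator {t<..} s"
    proof (cases "t < s")
      case True
      then have d: "0 < u - exp (- (s / 4))" by (simp add: u_def)
      obtain m0 where m0: "1 / (u - exp (- (s / 4))) \<le> real m0" using real_arch_simple by blast
      have "q m (exp (- (s / 4))) = 1" if "m0 \<le> m" for m
      proof -
        have "1 / (u - exp (- (s / 4))) \<le> real m" using m0 that by linarith
        then have "1 \<le> real m * (u - exp (- (s / 4)))" using d by (simp add: field_simps)
        then show ?thesis by (simp add: q_def)
      qed
      then have "\<forall>\<^sub>F m in sequentially. q m (exp (- (s / 4))) = 1"
        by (rule eventually_sequentiallyI)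
      then show ?thesis using True by (simp add: tendsto_eventually)
    next
      case False
      then have "u - exp (- (s / 4)) \<le> 0" by (simp add: u_def)
      then have "real m * (u - exp (- (s / 4))) \<le> 0" for m
        by (intro mult_nonneg_nonpos) auto
      then have "q m (exp (- (s / 4))) = 0" for m
        by (simp add: q_def max.absorb1 del: right_diff_distrib)
      then show ?thesis using False by simp
    qed
    have "(\<lambda>m. q m (exp (- (s / 4))) - k m s) \<longlonglongrightarrow> 0"
      by (rule Lim_null_comparison[OF _ LIMSEQ_Suc[OF lim_1_over_n]])
        (use approx[OF s] in \<open>auto intro!: always_eventually less_imp_le\<close>)
    from tendsto_diff[OF lim this] show "(\<lambda>m. k m s) \<longlonglongrightarrow> indicator {t<..} s" by simp
    show "\<bar>k m s\<bar> \<le> 2 * exp (3 * s / 8)" for m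
    proof -
      have "1 / real (Suc m) \<le> 1" by simp
      moreover have "0 \<le> q m (exp (- (s / 4)))" "q m (exp (- (s / 4))) \<le> 1" by (auto simp: q_def)
      ultimately have "\<bar>k m s\<bar> \<le> 2 * 1" using approx[OF s, of m] by linarith
      also have "\<dots> \<le> 2 * exp (3 * s / 8)" using s by (intro mult_left_mono) auto
      finally show ?thesis .
    qed
  qed measurable
qed

section \<open>Approximation of the semigroup and of the Cesaro operator\<close>

lemma exp_quarter_bounds:
  assumes "0 \<le> r" "r \<le> (1::real)"
  shows "1 \<le> ennreal (exp (1 / 4)) * ennreal (exp (- (r / 4)))"
proof -
  have "1 \<le> exp (1 / 4 - r / 4)" using assms by simp
  then show ?thesis by (simp add: ennreal_mult'[symmetric] exp_add[symmetric])
qed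

text \<open>
  The kernel is the normalised indicator function of \<open>(t, t + 1 / (n + 1)]\<close>. These kernels have no common
  admissible bound, but after rescaling the interval to \<open>(0, 1]\<close> the average is
  \<open>\<integral>\<^sub>0\<^sup>1 S\<^sub>t\<^sub>+\<^sub>r\<^sub>/\<^sub>(\<^sub>n\<^sub>+\<^sub>1\<^sub>) F dr\<close>, and dominated convergence applies to it.
\<close>

lemma sqnorm_difference_quotient_tendsto:
  assumes F [measurable]: "F \<in> borel_measurable borel" and fin: "sqnorm F < \<infinity>" and "0 \<le> t"
  shows "(\<lambda>n. sqnorm (\<lambda>x. time_average (\<lambda>s. real (Suc n) * (indicator {t<..} s - indicator {t + 1 / Suc n<..} s)) F x
    - weighted_comp t F x)) \<longlonglongrightarrow> 0"
proof -
  define k where "k = (\<lambda>n s. real (Suc n) * (indicator {t<..} s - indicator {t + 1 / Suc n<..} s))"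
  define D where "D = (\<lambda>n r x. indicator {0<..1} r *\<^sub>R (weighted_comp (t + r / Suc n) F x - weighted_comp t F x))"
  have [measurable]: "k n \<in> borel_measurable borel" for n
    unfolding k_def by measurable
  have kB: "admissible_kernel (k n) (Suc n)" for n
    unfolding admissible_kernel_def
  proof (intro conjI allI impI)
    fix s :: real assume "0 \<le> s"
    have "\<bar>k n s\<bar> \<le> real (Suc n) * 1"
      unfolding k_def abs_mult by (intro mult_mono) (auto simp: indicator_def)
    also have "\<dots> \<le> real (Suc n) * exp (3 * s / 8)"
      using \<open>0 \<le> s\<close> by (intro mult_left_mono) auto
    finally show "\<bar>k n s\<bar> \<le> real (Suc n) * exp (3 * s / 8)" .
  qed measurable
  have "sqnorm (\<lambda>x. time_average (k n) F x - weighted_comp t F x)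
      = sqnorm (\<lambda>x. LINT r:{0..}|lborel. D n r x)" for n
  proof (rule sqnorm_cong_AE)
    show "AE x in lborel. x \<in> {0<..<1} \<longrightarrow>
       time_average (k n) F x - weighted_comp t F x = (LINT r:{0..}|lborel. D n r x)"
      using AE_kernel_integrable[OF kB F fin]
    proof eventually_elim
      fix x
      let ?h = "\<lambda>s. indicator {0..} s *\<^sub>R (complex_of_real (k n s) * weighted_comp s F x)"
      let ?w = "\<lambda>r. indicator {0<..1} r *\<^sub>R weighted_comp (t + r / Suc n) F x"
      assume int: "x \<in> {0<..<1} \<longrightarrow> set_integrable lborel {0..} (\<lambda>s. complex_of_real (k n s) * weighted_comp s F x)"
      show "x \<in> {0<..<1} \<longrightarrow> time_average (k n) F x - weighted_comp t F x = (LINT r:{0..}|lborel. D n r x)"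
      proof
        assume "x \<in> {0<..<1}"
        with int have h: "integrable lborel ?h" by (simp add: set_integrable_def)
        \<comment> \<open>the change of variables \<open>s = t + r / (n + 1)\<close>, including its Jacobian\<close>
        have hw: "(1 / Suc n) *\<^sub>R ?h (t + (1 / Suc n) * r) = ?w r" for r
        proof -
          define c where "c = 1 / real (Suc n)"
          have c: "0 < c" "c * real (Suc n) = 1" by (simp_all add: c_def)
          have "t < t + c * r \<longleftrightarrow> 0 < r" "t + c < t + c * r \<longleftrightarrow> 1 < r"
            using c(1) mult_less_cancel_left_pos[of c 1 r] by (simp_all add: zero_less_mult_iff)
          moreover have "0 < r \<Longrightarrow> 0 \<le> t + c * r"
            using c(1) \<open>0 \<le> t\<close> by simp
          ultimately have "indicator {0..} (t + c * r) * (indicator {t<..} (t + c * r) - indicator {t + c<..} (t + c * r)) = (indicator {0<..1} r :: real)"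
            by (auto simp: indicator_def)
          then have "c * (indicator {0..} (t + c * r) * (real (Suc n) * (indicator {t<..} (t + c * r) - indicator {t + c<..} (t + c * r)))) = (indicator {0<..1} r :: real)"
            using c(2) by (metis (no_types, opaque_lifting) mult.left_commute mult.assoc mult_1)
          then have "(1 / real (Suc n)) * (indicator {0..} (t + (1 / Suc n) * r) * k n (t + (1 / Suc n) * r)) = (indicator {0<..1} r :: real)"
            unfolding k_def c_def .
          then have "complex_of_real ((1 / real (Suc n)) * (indicator {0..} (t + (1 / Suc n) * r) * k n (t + (1 / Suc n) * r)))
            * weighted_comp (t + (1 / Suc n) * r) F x = complex_of_real (indicator {0<..1} r) * weighted_comp (t + (1 / Suc n) * r) F x"
            by (rule arg_cong)
          then show ?thesis by (simp add: scaleR_conv_of_real mult.assoc)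
        qed
        have w: "integrable lborel ?w"
          unfolding hw[symmetric]
          by (intro integrable_scaleR_right lborel_integrable_real_affine h) simp
        have c: "integrable lborel (\<lambda>r. indicator {0<..1::real} r *\<^sub>R weighted_comp t F x)"
          by (intro integrable_indicator) (simp_all add: emeasure_lborel_Ioc)
        have "(LINT r:{0..}|lborel. D n r x) = (\<integral>r. ?w r - indicator {0<..1} r *\<^sub>R weighted_comp t F x \<partial>lborel)"
          unfolding set_lebesgue_integral_def D_def
          by (intro Bochner_Integration.integral_cong) (auto simp: indicator_def)
        also have "\<dots> = (\<integral>r. ?w r \<partial>lborel) - (\<integral>r. indicator {0<..1::real} r *\<^sub>R weighted_comp t F x \<partial>lborel)"
          using w c by (rule Bochner_Integration.integral_diff)
        also have "(\<integral>r. indicator {0<..1::real} r *\<^sub>R weighted_comp t F x \<partial>lborel) = weighted_comp t F x"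
          by simp
        also have "(\<integral>r. ?w r \<partial>lborel) = (1 / Suc n) *\<^sub>R (\<integral>r. ?h (t + (1 / Suc n) * r) \<partial>lborel)"
          unfolding hw[symmetric] by (rule integral_scaleR_right)
        also have "\<dots> = (\<integral>s. ?h s \<partial>lborel)"
          using lborel_integral_real_affine[of "1 / Suc n" ?h t] by simp
        also have "\<dots> = time_average (k n) F x"
          by (simp add: time_average_def set_lebesgue_integral_def)
        finally show "time_average (k n) F x - weighted_comp t F x = (LINT r:{0..}|lborel. D n r x)" ..
      qed
    qed
  qed
  moreover have "(\<lambda>n. sqnorm (\<lambda>x. LINT r:{0..}|lborel. D n r x)) \<longlonglongrightarrow> 0"
  proof (rule sqnorm_time_integral_tendsto_0)
    show "(\<lambda>(r, x). D n r x) \<in> borel_measurable (borel \<Otimes>\<^sub>M borel)" for n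
      unfolding D_def by measurable
    \<comment> \<open>the factor \<open>exp (1 / 4)\<close> offsets the weight \<open>exp (- r / 4)\<close> on \<open>(0, 1]\<close>\<close>
    show "ennreal (exp (1 / 4)) * (4 * sqnorm F) < \<infinity>"
      using fin by (simp add: ennreal_mult_less_top)
    fix r :: real assume r: "0 \<le> r"
    have D_eq: "D n r = (if r \<in> {0<..1} then (\<lambda>x. weighted_comp (t + r / Suc n) F x - weighted_comp t F x) else (\<lambda>x. 0))" for n
      by (auto simp: D_def)
    show "sqnorm (D n r) \<le> ennreal (exp (1 / 4)) * (4 * sqnorm F) * ennreal (exp (- (r / 4)))" for n
    proof (cases "r \<in> {0<..1}")
      case True
      have "sqnorm (D n r) \<le> 2 * sqnorm (weighted_comp (t + r / Suc n) F) + 2 * sqnorm (weighted_comp t F)"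
        using True by (simp only: D_eq if_True) (rule sqnorm_diff_le; measurable)
      also have "\<dots> \<le> 2 * sqnorm F + 2 * sqnorm F"
        using r \<open>0 \<le> t\<close> by (intro add_mono mult_left_mono sqnorm_weighted_comp_le F) auto
      also have "\<dots> = 1 * (4 * sqnorm F)"
        by (simp add: distrib_right[symmetric])
      also have "\<dots> \<le> (ennreal (exp (1 / 4)) * ennreal (exp (- (r / 4)))) * (4 * sqnorm F)"
        using True by (intro mult_right_mono exp_quarter_bounds) auto
      finally show ?thesis by (simp add: mult_ac)
    qed (auto simp: D_eq sqnorm_def)
    show "(\<lambda>n. sqnorm (D n r)) \<longlonglongrightarrow> 0"
    proof (cases "r \<in> {0<..1}")
      case True
      have "(\<lambda>n. t + r * (1 / Suc n)) \<longlonglongrightarrow> t + r * 0"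
        by (intro tendsto_intros LIMSEQ_Suc[OF lim_1_over_n])
      then have "(\<lambda>n. t + r / Suc n) \<longlonglongrightarrow> t" by simp
      then show ?thesis
        using True r \<open>0 \<le> t\<close>
        by (simp only: D_eq if_True) (rule weighted_comp_strongly_continuous[OF F fin]; simp)
    qed (auto simp: D_eq sqnorm_def)
  qed
  ultimately show ?thesis unfolding k_def by simp
qed

lemma weighted_comp_invariant_borel:
  assumes M: "L2_closed_subspace M" and one: "invariant_kernel M (\<lambda>_. 1)"
    and F: "F \<in> M" "F \<in> borel_measurable borel" and "0 \<le> t"
  shows "weighted_comp t F \<in> M"
proof (rule closed_subspace_limit[OF M])
  let ?k = "\<lambda>n s. real (Suc n) * (indicator {t<..} s - indicator {t + 1 / Suc n<..} s)"
  have fin: "sqnorm F < \<infinity>" by (rule closed_subspace_sqnorm_finite[OF M F])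
  have "invariant_kernel M (?k n)" for n
    by (intro invariant_kernel_cmult invariant_kernel_diff invariant_kernel_tail M one)
  then show "time_average (?k n) F \<in> M" for n
    using F unfolding invariant_kernel_def by blast
  show "time_average (?k n) F \<in> borel_measurable borel" for n
    using F(2) by measurable
  show "weighted_comp t F \<in> borel_measurable borel"
    using F(2) by measurable
  show "sqnorm (weighted_comp t F) < \<infinity>"
    using fin F(2) by (simp add: sqnorm_weighted_comp ennreal_mult_less_top)
  show "(\<lambda>n. sqnorm (\<lambda>x. time_average (?k n) F x - weighted_comp t F x)) \<longlonglongrightarrow> 0"
    by (rule sqnorm_difference_quotient_tendsto[OF F(2) fin \<open>0 \<le> t\<close>])
qed

lemma sum_indicator_partition:
  fixes g :: "nat \<Rightarrow> 'a::real_vector"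
  assumes "0 < N" "0 \<le> s"
  shows "(\<Sum>j<N * N. indicator {real j / N..<(real j + 1) / N} s *\<^sub>R g j)
     = (if s < real N then g (nat \<lfloor>s * N\<rfloor>) else 0)"
proof -
  have iff: "s \<in> {real j / N..<(real j + 1) / N} \<longleftrightarrow> j = nat \<lfloor>s * N\<rfloor>" for j
  proof -
    have "s \<in> {real j / N..<(real j + 1) / N} \<longleftrightarrow> real j \<le> s * N \<and> s * N < real j + 1"
      using \<open>0 < N\<close> by (auto simp: field_simps)
    also have "\<dots> \<longleftrightarrow> \<lfloor>s * N\<rfloor> = int j"
      by (simp add: floor_eq_iff)
    also have "\<dots> \<longleftrightarrow> j = nat \<lfloor>s * N\<rfloor>"
      using \<open>0 \<le> s\<close> by auto
    finally show ?thesis .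
  qed
  have "nat \<lfloor>s * N\<rfloor> < N * N \<longleftrightarrow> s < real N"
  proof -
    have "nat \<lfloor>s * N\<rfloor> < N * N \<longleftrightarrow> s * N < real N * real N"
      using \<open>0 \<le> s\<close> by (subst nat_less_iff) (auto simp: floor_less_iff)
    then show ?thesis using \<open>0 < N\<close> by simp
  qed
  moreover have "indicator {real j / N..<(real j + 1) / N} s *\<^sub>R g j = (if j = nat \<lfloor>s * N\<rfloor> then g j else 0)" for j
    by (cases "j = nat \<lfloor>s * N\<rfloor>") (simp_all only: indicator_simps iff simp_thms if_True if_False scaleR_one scaleR_zero_left not_False_eq_True)
  ultimately show ?thesis
    by (simp only:) (simp add: sum.delta del: nat_less_iff)
qed

text \<open>
  The mesh is \<open>1 / N\<close> and the sum covers \<open>[0, N)\<close> with \<open>N = n + 1\<close>, so the cut-off tail disappears in the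
  limit as well. The sum is the time integral of the step function \<open>s \<mapsto> S\<^sub>\<tau> F\<close>, where \<open>\<tau>\<close> rounds \<open>s\<close> down to the mesh.
  Since \<open>\<tau> \<ge> s - 1\<close>, it has the same exponential decay as the semigroup itself.
\<close>

lemma riemann_sums_tendsto:
  assumes F [measurable]: "F \<in> borel_measurable borel" and fin: "sqnorm F < \<infinity>"
  shows "(\<lambda>n. sqnorm (\<lambda>x. (\<Sum>j<Suc n * Suc n. complex_of_real (1 / Suc n) * weighted_comp (real j / Suc n) F x)
     - time_average (\<lambda>_. 1) F x)) \<longlonglongrightarrow> 0"
proof -
  define D where "D = (\<lambda>n s x. (\<Sum>j<Suc n * Suc n. indicator {real j / Suc n..<(real j + 1) / Suc n} s *\<^sub>R weighted_comp (real j / Suc n) F x)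
     - weighted_comp s F x)"
  define \<tau> where "\<tau> = (\<lambda>n s. real (nat \<lfloor>s * real (Suc n)\<rfloor>) / Suc n)"
  have oneB: "admissible_kernel (\<lambda>_. 1) 1"
    by (simp add: admissible_kernel_def)
  have D_eq: "D n s = (if s < real (Suc n) then (\<lambda>x. weighted_comp (\<tau> n s) F x - weighted_comp s F x) else (\<lambda>x. - weighted_comp s F x))"
    if "0 \<le> s" for n s
  proof
    fix x
    have "(\<Sum>j<Suc n * Suc n. indicator {real j / Suc n..<(real j + 1) / Suc n} s *\<^sub>R weighted_comp (real j / Suc n) F x)
      = (if s < real (Suc n) then weighted_comp (real (nat \<lfloor>s * real (Suc n)\<rfloor>) / Suc n) F x else 0)"
      by (rule sum_indicator_partition) (use that in auto)
    then show "D n s x = (if s < real (Suc n) then (\<lambda>x. weighted_comp (\<tau> n s) F x - weighted_comp s F x) else (\<lambda>x. - weighted_comp s F x)) x"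
      unfolding D_def \<tau>_def by (simp only:) simp
  qed
  have \<tau>: "0 \<le> \<tau> n s" "s - 1 / Suc n \<le> \<tau> n s" "\<tau> n s \<le> s" if "0 \<le> s" for n s
  proof -
    have "0 \<le> s * real (Suc n)" using that by simp
    then have "real (nat \<lfloor>s * real (Suc n)\<rfloor>) = of_int \<lfloor>s * real (Suc n)\<rfloor>" by simp
    then have *: "real (nat \<lfloor>s * real (Suc n)\<rfloor>) \<le> s * real (Suc n)" "s * real (Suc n) - 1 \<le> real (nat \<lfloor>s * real (Suc n)\<rfloor>)"
      by linarith+
    have "s - 1 / Suc n = (s * real (Suc n) - 1) / real (Suc n)" "s = s * real (Suc n) / real (Suc n)"
      by (simp_all add: diff_divide_distrib del: of_nat_Suc)
    then show "0 \<le> \<tau> n s" "s - 1 / Suc n \<le> \<tau> n s" "\<tau> n s \<le> s"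
      using *[THEN divide_right_mono, of "real (Suc n)"] by (simp_all only: \<tau>_def of_nat_0_le_iff divide_nonneg_nonneg)
  qed
  have "sqnorm (\<lambda>x. (\<Sum>j<Suc n * Suc n. complex_of_real (1 / Suc n) * weighted_comp (real j / Suc n) F x) - time_average (\<lambda>_. 1) F x)
      = sqnorm (\<lambda>x. LINT s:{0..}|lborel. D n s x)" for n
  proof (rule sqnorm_cong_AE)
    show "AE x in lborel. x \<in> {0<..<1} \<longrightarrow>
      (\<Sum>j<Suc n * Suc n. complex_of_real (1 / Suc n) * weighted_comp (real j / Suc n) F x) - time_average (\<lambda>_. 1) F x
       = (LINT s:{0..}|lborel. D n s x)"
      using AE_kernel_integrable[OF oneB F fin]
    proof eventually_elim
      fix x
      let ?A = "\<lambda>j. {real j / Suc n..<(real j + 1) / Suc n}"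
      assume int: "x \<in> {0<..<1} \<longrightarrow> set_integrable lborel {0..} (\<lambda>s. complex_of_real 1 * weighted_comp s F x)"
      show "x \<in> {0<..<1} \<longrightarrow> (\<Sum>j<Suc n * Suc n. complex_of_real (1 / Suc n) * weighted_comp (real j / Suc n) F x)
          - time_average (\<lambda>_. 1) F x = (LINT s:{0..}|lborel. D n s x)"
      proof
        assume "x \<in> {0<..<1}"
        with int have h: "integrable lborel (\<lambda>s. indicator {0..} s *\<^sub>R weighted_comp s F x)"
          by (simp add: set_integrable_def)
        have A: "integrable lborel (\<lambda>s. indicator (?A j) s *\<^sub>R weighted_comp (real j / Suc n) F x)" for j
          by (intro integrable_indicator) (simp_all add: emeasure_lborel_Ico divide_right_mono)
        have "(LINT s:{0..}|lborel. D n s x)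
          = (\<integral>s. (\<Sum>j<Suc n * Suc n. indicator (?A j) s *\<^sub>R weighted_comp (real j / Suc n) F x) - indicator {0..} s *\<^sub>R weighted_comp s F x \<partial>lborel)"
          unfolding set_lebesgue_integral_def
        proof (rule Bochner_Integration.integral_cong[OF refl])
          fix s :: real
          have "s \<notin> ?A j" if "s < 0" for j
          proof -
            have "0 \<le> real j / real (Suc n)" by simp
            with that have "s < real j / real (Suc n)" by linarith
            then show ?thesis by (simp del: of_nat_Suc)
          qed
          then show "indicator {0..} s *\<^sub>R D n s x
            = (\<Sum>j<Suc n * Suc n. indicator (?A j) s *\<^sub>R weighted_comp (real j / Suc n) F x) - indicator {0..} s *\<^sub>R weighted_comp s F x"
            by (cases "0 \<le> s") (simp_all add: D_def del: of_nat_Suc mult_Suc mult_Suc_right)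
        qed
        also have "\<dots> = (\<Sum>j<Suc n * Suc n. \<integral>s. indicator (?A j) s *\<^sub>R weighted_comp (real j / Suc n) F x \<partial>lborel)
            - (\<integral>s. indicator {0..} s *\<^sub>R weighted_comp s F x \<partial>lborel)"
          by (subst Bochner_Integration.integral_diff[OF Bochner_Integration.integrable_sum[OF A] h])
            (simp only: Bochner_Integration.integral_sum[OF A])
        also have "(\<integral>s. indicator {0..} s *\<^sub>R weighted_comp s F x \<partial>lborel) = time_average (\<lambda>_. 1) F x"
          by (simp add: time_average_def set_lebesgue_integral_def)
        also have "(\<Sum>j<Suc n * Suc n. \<integral>s. indicator (?A j) s *\<^sub>R weighted_comp (real j / Suc n) F x \<partial>lborel)
            = (\<Sum>j<Suc n * Suc n. complex_of_real (1 / Suc n) * weighted_comp (real j / Suc n) F x)"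
        proof (rule sum.cong[OF refl])
          fix j :: nat
          have "measure lborel (?A j) = 1 / Suc n"
            by (simp add: divide_right_mono diff_divide_distrib[symmetric])
          then show "(\<integral>s. indicator (?A j) s *\<^sub>R weighted_comp (real j / Suc n) F x \<partial>lborel)
              = complex_of_real (1 / Suc n) * weighted_comp (real j / Suc n) F x"
            by (simp add: scaleR_conv_of_real del: of_nat_Suc)
        qed
        finally show "(\<Sum>j<Suc n * Suc n. complex_of_real (1 / Suc n) * weighted_comp (real j / Suc n) F x)
          - time_average (\<lambda>_. 1) F x = (LINT s:{0..}|lborel. D n s x)" ..
      qed
    qed
  qed
  moreover have "(\<lambda>n. sqnorm (\<lambda>x. LINT s:{0..}|lborel. D n s x)) \<longlonglongrightarrow> 0"
  proof (rule sqnorm_time_integral_tendsto_0)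
    show "(\<lambda>(s, x). D n s x) \<in> borel_measurable (borel \<Otimes>\<^sub>M borel)" for n
      unfolding D_def by measurable
    let ?B = "ennreal (4 * exp 1) * sqnorm F"
    show "?B < \<infinity>" using fin by (simp add: ennreal_mult_less_top)
    fix s :: real assume s: "0 \<le> s"
    have decay: "2 * sqnorm (weighted_comp u F) \<le> ennreal (2 * exp 1) * ennreal (exp (- (s / 4))) * sqnorm F"
      if "s - 1 \<le> u" for u
    proof -
      have "2 * exp (-u) \<le> 2 * exp 1 * exp (- (s / 4))"
        using that s by (simp add: exp_add[symmetric])
      then have "2 * ennreal (exp (-u)) \<le> ennreal (2 * exp 1) * ennreal (exp (- (s / 4)))"
        by (simp add: ennreal_mult'[symmetric] flip: ennreal_numeral)
      then have "2 * ennreal (exp (-u)) * sqnorm F \<le> ennreal (2 * exp 1) * ennreal (exp (- (s / 4))) * sqnorm F"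
        by (rule mult_right_mono) simp
      then show ?thesis by (simp add: sqnorm_weighted_comp[OF F] mult.assoc)
    qed
    have double: "ennreal (2 * exp 1) * ennreal (exp (- (s / 4))) * sqnorm F + ennreal (2 * exp 1) * ennreal (exp (- (s / 4))) * sqnorm F
      = ?B * ennreal (exp (- (s / 4)))"
    proof -
      have "ennreal (4 * exp 1) = ennreal (2 * exp 1) + ennreal (2 * exp 1)"
        by (subst ennreal_plus[symmetric]) auto
      then show ?thesis by (simp add: distrib_right distrib_left mult_ac)
    qed
    show "sqnorm (D n s) \<le> ?B * ennreal (exp (- (s / 4)))" for n
    proof (cases "s < real (Suc n)")
      case True
      have "1 / real (Suc n) \<le> 1" by simp
      then have "s - 1 \<le> \<tau> n s" using \<tau>(2)[OF s, of n] by linarith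
      then have "2 * sqnorm (weighted_comp (\<tau> n s) F) + 2 * sqnorm (weighted_comp s F) \<le> ?B * ennreal (exp (- (s / 4)))"
        unfolding double[symmetric] by (intro add_mono decay) auto
      moreover have "sqnorm (D n s) \<le> 2 * sqnorm (weighted_comp (\<tau> n s) F) + 2 * sqnorm (weighted_comp s F)"
        unfolding D_eq[OF s] using True by (simp only: if_True) (rule sqnorm_diff_le; measurable)
      ultimately show ?thesis by (rule order_trans[rotated])
    next
      case False
      have "sqnorm (D n s) \<le> 2 * sqnorm (weighted_comp s F) + 2 * sqnorm (weighted_comp s F)"
        unfolding D_eq[OF s] using False by (simp add: mult_2 add_increasing2)
      also have "\<dots> \<le> ?B * ennreal (exp (- (s / 4)))"
        unfolding double[symmetric] by (intro add_mono decay) auto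
      finally show ?thesis .
    qed
    show "(\<lambda>n. sqnorm (D n s)) \<longlonglongrightarrow> 0"
    proof -
      have "(\<lambda>n. \<tau> n s) \<longlonglongrightarrow> s"
      proof (rule tendsto_sandwich)
        show "(\<lambda>n. s - 1 / Suc n) \<longlonglongrightarrow> s"
          using tendsto_diff[OF tendsto_const LIMSEQ_Suc[OF lim_1_over_n], of s] by simp
      qed (use \<tau>[OF s] in \<open>auto simp del: of_nat_Suc\<close>)
      with \<tau>(1)[OF s] s
      have "(\<lambda>n. sqnorm (\<lambda>x. weighted_comp (\<tau> n s) F x - weighted_comp s F x)) \<longlonglongrightarrow> 0"
        by (intro weighted_comp_strongly_continuous[OF F fin])
      moreover obtain n0 where "s < real n0" using reals_Archimedean2 by blast
      then have "\<forall>\<^sub>F n in sequentially. sqnorm (\<lambda>x. weighted_comp (\<tau> n s) F x - weighted_comp s F x) = sqnorm (D n s)"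
        by (intro eventually_sequentiallyI[of n0]) (simp add: D_eq[OF s])
      ultimately show ?thesis by (rule Lim_transform_eventually)
    qed
  qed
  ultimately show ?thesis by simp
qed

theorem theorem6p1:
  fixes M :: "(real \<Rightarrow> complex) set"
  assumes "L2_closed_subspace M"
  shows "(cesaro ` M \<subseteq> M) \<longleftrightarrow> (\<forall>t\<ge>0. weighted_comp t ` M \<subseteq> M)"
proof
  note M = assms
  have representative: "\<exists>F. F \<in> M \<and> F \<in> borel_measurable borel \<and> (AE x in lborel. x \<in> {0<..<1} \<longrightarrow> f x = F x)"
    if "f \<in> M" for f
  proof -
    have "f \<in> L2" using M that by (auto simp: L2_closed_subspace_def L2_subspace_def)
    then obtain F where "F \<in> borel_measurable borel" "AE x in lborel. x \<in> {0<..<1} \<longrightarrow> f x = F x"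
      by (rule L2_borel_representative)
    then show ?thesis using closed_subspace_cong_AE[OF M that] by blast
  qed
  have oneB: "admissible_kernel (\<lambda>_. 1) 1"
    by (simp add: admissible_kernel_def)
  {
    assume C: "cesaro ` M \<subseteq> M"
    have "time_average (\<lambda>_. 1) F \<in> M" if F: "F \<in> M" "F \<in> borel_measurable borel" for F
    proof (rule closed_subspace_cong_AE[OF M])
      show "cesaro F \<in> M" using C F(1) by blast
      show "time_average (\<lambda>_. 1) F \<in> borel_measurable borel" using F(2) by measurable
      show "AE x in lborel. x \<in> {0<..<1} \<longrightarrow> cesaro F x = time_average (\<lambda>_. 1) F x"
        using cesaro_eq_time_average[OF F(2) closed_subspace_sqnorm_finite[OF M F]] by simp
    qed
    with oneB have one: "invariant_kernel M (\<lambda>_. 1)" by (auto simp: invariant_kernel_def)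
    show "\<forall>t\<ge>0. weighted_comp t ` M \<subseteq> M"
    proof (intro allI impI subsetI, elim imageE, hypsubst)
      fix t :: real and f assume t: "0 \<le> t" and f: "f \<in> M"
      obtain F where F: "F \<in> M" "F \<in> borel_measurable borel" and eq: "AE x in lborel. x \<in> {0<..<1} \<longrightarrow> f x = F x"
        using representative[OF f] by blast
      show "weighted_comp t f \<in> M"
      proof (rule closed_subspace_representative_cong[OF M])
        show "weighted_comp t F \<in> M" by (rule weighted_comp_invariant_borel[OF M one F t])
        show "weighted_comp t F \<in> borel_measurable borel" using F(2) by measurable
        show "AE x in lborel. x \<in> {0<..<1} \<longrightarrow> weighted_comp t f x = weighted_comp t F x"
          by (rule weighted_comp_cong_AE[OF eq])
      qed
    qed
  }
  {
    assume S: "\<forall>t\<ge>0. weighted_comp t ` M \<subseteq> M"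
    show "cesaro ` M \<subseteq> M"
    proof (intro subsetI, elim imageE, hypsubst)
      fix f assume f: "f \<in> M"
      obtain F where F: "F \<in> M" and F' [measurable]: "F \<in> borel_measurable borel"
        and eq: "AE x in lborel. x \<in> {0<..<1} \<longrightarrow> f x = F x"
        using representative[OF f] by blast
      have fin: "sqnorm F < \<infinity>" by (rule closed_subspace_sqnorm_finite[OF M F F'])
      have SF: "weighted_comp t F \<in> M" if "0 \<le> t" for t
        using S F that by blast
      have T: "time_average (\<lambda>_. 1) F \<in> M"
      proof (rule closed_subspace_limit[OF M])
        let ?R = "\<lambda>n x. \<Sum>j<Suc n * Suc n. complex_of_real (1 / Suc n) * weighted_comp (real j / Suc n) F x"
        show "?R n \<in> M" for n
          by (intro closed_subspace_sum[OF M] closed_subspace_cmult[OF M] SF) auto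
        show "?R n \<in> borel_measurable borel" for n by measurable
        show "time_average (\<lambda>_. 1) F \<in> borel_measurable borel" by measurable
        show "sqnorm (time_average (\<lambda>_. 1) F) < \<infinity>"
          by (rule sqnorm_time_average_finite[OF oneB F' fin])
        show "(\<lambda>n. sqnorm (\<lambda>x. ?R n x - time_average (\<lambda>_. 1) F x)) \<longlonglongrightarrow> 0"
          by (rule riemann_sums_tendsto[OF F' fin])
      qed
      show "cesaro f \<in> M"
      proof (rule closed_subspace_representative_cong[OF M T])
        show "time_average (\<lambda>_. 1) F \<in> borel_measurable borel" by measurable
        show "AE x in lborel. x \<in> {0<..<1} \<longrightarrow> cesaro f x = time_average (\<lambda>_. 1) F x"
          using cesaro_cong_AE[OF eq F'] cesaro_eq_time_average[OF F' fin] by simp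
      qed
    qed
  }
qed

end
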